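(* Let $F$ satisfy the standing assumptions below and the symmetry condition (SYM). Let $T>0$, $M>0$, and let $u:\mathbb{R}^n\times[0,T]\to\mathbb{R}$ be a $C^3$ solution of (AMCF) with $|u|\le M$, periodic with respect to a lattice $L\subset\mathbb{R}^n$ (i.e. $u(x+\ell,t)=u(x,t)$ for all $\ell\in L$). Then there are constants $A>0$ depending only on $F$ (and $n$), $S>F(-\phi^0)$ depending only on $F$ and $n$, and a time $T'\in(0,T]$ depending on $M$ (and $A$), such that $$F(Du-\phi^0)(x,t)\le\max\left\{ t\exp\!\left(\frac{A\,(|u(x,t)|-2M)^2}{2t}\right),\ S\right\}$$ for all $x\in\mathbb{R}^n$ and $0<t\le T'$.
   Context: Let $V\cong\mathbb{R}^{n+1}$ with basis $e_0,\dots,e_n$ and $V^*$ with dual basis $\phi^0,\dots,\phi^n$. Standing assumptions on $F$: $F:V^*\to\mathbb{R}$ is positive (on $V^*\setminus\{0\}$), convex, $C^3$ on $V^*\setminus\{0\}$, homogeneous of degree one, and each sublevel set $\{F\le\lambda\}$ is uniformly convex. $D^kF|_\nu$ is the $k$-th derivative of $F$ at $\nu$ as a symmetric $k$-linear form. For $u(y,t)$, $y\in\mathbb{R}^n$, write $u_i=\partial u/\partial y^i$, $u_{ij}=\partial^2 u/\partial y^i\partial y^j$, $Du=\sum_{i=1}^n u_i\phi^i$. (AMCF) is the equation $u_t=\sum_{i,j=1}^n F(\nu)D^2F|_\nu(\phi^i,\phi^j)u_{ij}$ with $\nu=Du-\phi^0$. Symmetry condition (SYM): $F(p+\phi^0)=F(p-\phi^0)$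 for all $p\in\operatorname{span}\{\phi^1,\dots,\phi^n\}$. *)

theory Defs
  imports "HOL-Analysis.Analysis"
begin

fun Ck_on :: "nat \<Rightarrow> 'a::real_normed_vector set \<Rightarrow> ('a \<Rightarrow> 'b::real_normed_vector) \<Rightarrow> bool" where
  "Ck_on 0 S f = continuous_on S f"
| "Ck_on (Suc k) S f =
     (f differentiable_on S \<and> (\<forall>v. Ck_on k S (\<lambda>x. frechet_derivative f (at x) v)))"

definition pd :: "('a::real_normed_vector \<Rightarrow> real) \<Rightarrow> 'a \<Rightarrow> 'a \<Rightarrow> real" where
  "pd f v p = frechet_derivative f (at p) v"

text \<open>The dual space V* = span{phi^1..phi^n} (+) span{phi^0} is modelled as
  (real^'n) \<times> real: phi^i = (axis i 1, 0) for i in 'n, phi^0 = (0, 1).\<close>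
definition phi0 :: "(real^'n) \<times> real" where "phi0 = (0, 1)"
definition phi :: "'n \<Rightarrow> (real^'n) \<times> real" where "phi i = (axis i 1, 0)"

definition D2 :: "('a::real_normed_vector \<Rightarrow> real) \<Rightarrow> 'a \<Rightarrow> 'a \<Rightarrow> 'a \<Rightarrow> real" where
  "D2 F nu v w = frechet_derivative (\<lambda>mu. frechet_derivative F (at mu) v) (at nu) w"

definition ui :: "((real^'n) \<times> real \<Rightarrow> real) \<Rightarrow> 'n \<Rightarrow> (real^'n) \<times> real \<Rightarrow> real" where
  "ui u i p = pd u (axis i 1, 0) p"
definition uij :: "((real^'n) \<times> real \<Rightarrow> real) \<Rightarrow> 'n \<Rightarrow> 'n \<Rightarrow> (real^'n) \<times> real \<Rightarrow> real" where
  "uij u i j p = pd (\<lambda>q. ui u j q) (axis i 1, 0) p"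
definition ut :: "((real^'n) \<times> real \<Rightarrow> real) \<Rightarrow> (real^'n) \<times> real \<Rightarrow> real" where
  "ut u p = pd u (0, 1) p"

definition nu :: "((real^'n) \<times> real \<Rightarrow> real) \<Rightarrow> (real^'n) \<times> real \<Rightarrow> (real^'n) \<times> real" where
  "nu u p = (\<Sum>i\<in>UNIV. ui u i p *\<^sub>R phi i) - phi0"

definition uniformly_convex_set :: "'a::real_normed_vector set \<Rightarrow> bool" where
  "uniformly_convex_set K \<longleftrightarrow> convex K \<and>
     (\<exists>c>0. \<forall>x\<in>K. \<forall>y\<in>K. cball (midpoint x y) (c * (norm (x - y))\<^sup>2) \<subseteq> K)"

definition standing_assumptions :: "((real^'n) \<times> real \<Rightarrow> real) \<Rightarrow> bool" where
  "standing_assumptions F \<longleftrightarrow>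
     (\<forall>v. v \<noteq> 0 \<longrightarrow> F v > 0) \<and>
     convex_on UNIV F \<and>
     Ck_on 3 (UNIV - {0}) F \<and>
     (\<forall>v. \<forall>c>0. F (c *\<^sub>R v) = c * F v) \<and>
     (\<forall>lam. uniformly_convex_set {v. F v \<le> lam})"

definition SYM :: "((real^'n) \<times> real \<Rightarrow> real) \<Rightarrow> bool" where
  "SYM F \<longleftrightarrow> (\<forall>p::real^'n. F ((p, 0) + phi0) = F ((p, 0) - phi0))"

definition lattice :: "(real^'n) set \<Rightarrow> bool" where
  "lattice L \<longleftrightarrow> (\<exists>b::'n \<Rightarrow> real^'n. inj b \<and> independent (range b) \<and>
      L = {(\<Sum>i\<in>UNIV. of_int (k i) *\<^sub>R b i) | k :: 'n \<Rightarrow> int. True})"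

definition AMCF_solution :: "((real^'n) \<times> real \<Rightarrow> real) \<Rightarrow> real \<Rightarrow> ((real^'n) \<times> real \<Rightarrow> real) \<Rightarrow> bool" where
  "AMCF_solution F T u \<longleftrightarrow>
     (\<exists>U. open U \<and> UNIV \<times> {0..T} \<subseteq> U \<and> Ck_on 3 U u) \<and>
     (\<forall>y t. 0 \<le> t \<and> t \<le> T \<longrightarrow>
        ut u (y, t) = (\<Sum>i\<in>UNIV. \<Sum>j\<in>UNIV.
            F (nu u (y, t)) * D2 F (nu u (y, t)) (phi i) (phi j) * uij u i j (y, t)))"

end

(*
  Maximum principle for Z = ln F(nu) - psi(u, t), psi(u, t) = ln t + A (2M - s u)^2 / (2t), s = 1 or -1;
  the minimum of the two barriers is the one with |u|. If Z had a positive value it would, by periodicity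
  and since psi tends to infinity as t -> 0, have a positive maximum, where F(nu) is large because t is small.
  There, with a = F psi', X_k = DF(phi^k), g = D^2 F restricted to span(phi^i), B = D^3 F(., ., phi^0) and
  h the Hessian of u, one has h X = a Du and
    F psi_t <= F^2 (psi'' + psi'^2) F00 + a (F0 <g, h> + F <B, h>) - F tr(g h g h).
  Decomposing h = (a / X.Du) Du Du^T + k with k X = 0 and rescaling nu to (e, -r), |e| = 1, the last two
  terms plus (3/2) a^2 F00 become a quadratic form in (a, k) that depends continuously on (e, r) and is
  negative definite at r = 0: there (SYM) gives F0 = 0 and B = 0, and uniform convexity makes g degenerate
  only in the direction e, on which k X = 0 gives control. Hence, for |Du| large,
    psi_t <= F F00 (psi'' - psi'^2 / 2) = A F F00 psi_t,
  contradicting psi_t < 0 when A F F00 >= 2.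
*)
theory Submission
  imports Defs
begin

section \<open>Iterated directional derivatives\<close>

text \<open>The rank-one part of the Hessian is the obstacle: after rescaling, its coefficient is b
  / r, unbounded as r tends to 0. It is harmless because (e, 0) = x + r phi0 at x = (e, -r), and
  Euler's relations kill x in D^2 F and lower the order in D^3 F, so the contractions of g and B
  with e e^T are divisible by r. The only b-term that survives at r = 0 is -2 b^2 F^2 F00, from B(e,
  e). It pays for the gain 3/2 with 1/2 to spare, and 3/2 is the value for which psi'' + psi'^2 -
  (3/2) psi'^2 equals A psi_t for this psi. The constraint k X = 0 moves with (e, r), so the sign
  near r = 0 comes from compactness and not from a fixed subspace; hence S is not explicit. Third
  derivatives of u occur both in the spatial second-order condition and in the evolution of F(nu),
  found by differentiating the equation along X, and they cancel. The time bound makes psi_t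
  negative and keeps the barrier above S, so a touching point lies where the algebra
  applies.\<close>

lemma has_derivative_pd:
  "f differentiable (at x) \<Longrightarrow> (f has_derivative (\<lambda>v. pd f v x)) (at x)"
  by (simp add: pd_def frechet_derivative_works)

lemma linear_pd: "f differentiable (at x) \<Longrightarrow> linear (\<lambda>v. pd f v x)"
  using has_derivative_linear has_derivative_pd by blast

lemma pd_eqI: "(f has_derivative f') (at x) \<Longrightarrow> pd f v x = f' v"
  by (metis frechet_derivative_at pd_def)

lemma pd_line:
  assumes "f differentiable (at (x + s *\<^sub>R d))"
  shows "((\<lambda>s. f (x + s *\<^sub>R d)) has_real_derivative pd f d (x + s *\<^sub>R d)) (at s within A)"
proof -
  have "((\<lambda>s. f (x + s *\<^sub>R d)) has_derivative (\<lambda>r. pd f (r *\<^sub>R d) (x + s *\<^sub>R d))) (at s)"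
    by (rule has_derivative_compose[of "\<lambda>s. x + s *\<^sub>R d" _ _ _ f])
      (auto intro!: derivative_eq_intros has_derivative_pd assms)
  then have "((\<lambda>s. f (x + s *\<^sub>R d)) has_real_derivative pd f d (x + s *\<^sub>R d)) (at s)"
    unfolding has_field_derivative_def
    by (rule has_derivative_eq_rhs)
      (simp add: linear_scale[OF linear_pd[OF assms]] fun_eq_iff mult.commute)
  then show ?thesis by (rule has_field_derivative_at_within)
qed

text \<open>A directional derivative sees the function only along its line. This matters where an
  identity, such as the flow equation, is available on horizontal lines but not on a
  neighbourhood.\<close>

lemma pd_eqI_line:
  assumes "f differentiable (at x)"
    and "((\<lambda>s. f (x + s *\<^sub>R d)) has_real_derivative D) (at 0)"
  shows "pd f d x = D"
  using pd_line[of f x 0 d UNIV] assms DERIV_unique by fastforce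

lemma Ck_on_SucD: "Ck_on (Suc k) S f \<Longrightarrow> Ck_on k S f"
proof (induction k arbitrary: f)
  case 0
  then show ?case by (simp add: differentiable_imp_continuous_on)
next
  case (Suc k)
  have *: "f differentiable_on S \<and> (\<forall>v. Ck_on (Suc k) S (\<lambda>x. frechet_derivative f (at x) v))"
    using Suc.prems unfolding Ck_on.simps(2)[of "Suc k" S f] .
  show ?case unfolding Ck_on.simps(2)[of k S f]
  proof (intro conjI allI)
    show "f differentiable_on S" using * by (rule conjunct1)
    fix v
    show "Ck_on k S (\<lambda>x. frechet_derivative f (at x) v)"
      by (rule Suc.IH) (rule spec[OF conjunct2[OF *]])
  qed
qed

lemma Ck_on_pd: "Ck_on (Suc k) S f \<Longrightarrow> Ck_on k S (pd f v)"
  by (simp add: pd_def[abs_def])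

lemma Ck_on_differentiable:
  assumes "Ck_on (Suc k) S f" "open S" "x \<in> S"
  shows "f differentiable (at x)"
proof -
  have "f differentiable_on S"
    using assms(1) unfolding Ck_on.simps(2) by (rule conjunct1)
  then show ?thesis using assms(2,3) by (metis differentiable_on_def at_within_open)
qed

lemma pd_cong:
  assumes "open S" "x \<in> S" "\<And>y. y \<in> S \<Longrightarrow> f y = g y" "f differentiable (at x)"
  shows "pd f v x = pd g v x"
  using frechet_derivative_transform_within_open[OF assms(4,1,2,3)] by (simp add: pd_def)

text \<open>Mean value theorem twice: for the difference in direction \<open>w\<close> as a function
  of the step along \<open>v\<close>, then for \<open>pd f v\<close> along \<open>w\<close>. The
  double difference is symmetric in \<open>v\<close> and \<open>w\<close>, hence the symmetry of
  second derivatives.\<close>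

lemma double_difference:
  fixes f :: "'a::real_normed_vector \<Rightarrow> real"
  assumes S: "open S" and f: "Ck_on (Suc (Suc 0)) S f" and "s > 0"
    and sq: "\<And>a b. a \<in> {0..s} \<Longrightarrow> b \<in> {0..s} \<Longrightarrow> x + a *\<^sub>R v + b *\<^sub>R w \<in> S"
  shows "\<exists>a b. a \<in> {0..s} \<and> b \<in> {0..s} \<and>
    f (x + s *\<^sub>R v + s *\<^sub>R w) - f (x + s *\<^sub>R v) - f (x + s *\<^sub>R w) + f x
      = s\<^sup>2 * pd (pd f v) w (x + a *\<^sub>R v + b *\<^sub>R w)"
proof -
  have d1: "f differentiable (at (x + a *\<^sub>R v + b *\<^sub>R w))"
    and d2: "pd f v differentiable (at (x + a *\<^sub>R v + b *\<^sub>R w))"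
    if "a \<in> {0..s}" "b \<in> {0..s}" for a b
    using Ck_on_differentiable[OF f S sq[OF that]]
      Ck_on_differentiable[OF Ck_on_pd[OF f] S sq[OF that]] by auto
  have eq: "y + s *\<^sub>R w + a *\<^sub>R v = y + a *\<^sub>R v + s *\<^sub>R w" for y a by (simp add: algebra_simps)
  have da: "((\<lambda>a. f (x + s *\<^sub>R w + a *\<^sub>R v) - f (x + a *\<^sub>R v)) has_real_derivative
      pd f v (x + s *\<^sub>R w + a *\<^sub>R v) - pd f v (x + a *\<^sub>R v)) (at a)" if "0 \<le> a" "a \<le> s" for a
  proof (intro DERIV_diff pd_line)
    show "f differentiable (at (x + s *\<^sub>R w + a *\<^sub>R v))"
      using d1[of a s] that \<open>s > 0\<close> unfolding eq by simp
    show "f differentiable (at (x + a *\<^sub>R v))" using d1[of a 0] that \<open>s > 0\<close> by simp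
  qed
  have "\<exists>z>0. z < s \<and> (f (x + s *\<^sub>R w + s *\<^sub>R v) - f (x + s *\<^sub>R v)) -
       (f (x + s *\<^sub>R w + 0 *\<^sub>R v) - f (x + 0 *\<^sub>R v))
     = (s - 0) * (pd f v (x + s *\<^sub>R w + z *\<^sub>R v) - pd f v (x + z *\<^sub>R v))"
    by (rule MVT2[OF \<open>s > 0\<close> da])
  then obtain a where a: "0 < a" "a < s"
    and ea: "f (x + s *\<^sub>R v + s *\<^sub>R w) - f (x + s *\<^sub>R v) - (f (x + s *\<^sub>R w) - f x)
     = s * (pd f v (x + a *\<^sub>R v + s *\<^sub>R w) - pd f v (x + a *\<^sub>R v))"
    by (auto simp: eq)
  have "\<exists>b>0. b < s \<and> pd f v (x + a *\<^sub>R v + s *\<^sub>R w) - pd f v (x + a *\<^sub>R v + 0 *\<^sub>R w)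
      = (s - 0) * pd (pd f v) w (x + a *\<^sub>R v + b *\<^sub>R w)"
    by (rule MVT2[OF \<open>s > 0\<close>, of "\<lambda>b. pd f v (x + a *\<^sub>R v + b *\<^sub>R w)"])
      (use d2[of a] a in \<open>auto intro!: pd_line\<close>)
  then obtain b where "0 < b" "b < s"
    "pd f v (x + a *\<^sub>R v + s *\<^sub>R w) - pd f v (x + a *\<^sub>R v) = s * pd (pd f v) w (x + a *\<^sub>R v + b *\<^sub>R w)"
    by auto
  with a ea show ?thesis by (intro exI[of _ a] exI[of _ b]) (auto simp: power2_eq_square)
qed

lemma pd_symmetric:
  fixes f :: "'a::real_normed_vector \<Rightarrow> real"
  assumes S: "open S" and f: "Ck_on (Suc (Suc 0)) S f" and x: "x \<in> S"
  shows "pd (pd f v) w x = pd (pd f w) v x"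
proof (rule ccontr)
  assume ne: "\<not> ?thesis"
  \<comment> \<open>Half the supposed gap: one value cannot be closer than this to both
    derivatives.\<close>
  define e where "e = \<bar>pd (pd f v) w x - pd (pd f w) v x\<bar> / 2"
  have e: "e > 0" using ne by (simp add: e_def)
  have cont: "continuous_on S (pd (pd f v) w)" for v w
    using Ck_on_pd[OF Ck_on_pd[OF f]] by simp
  obtain d0 where d0: "d0 > 0" "ball x d0 \<subseteq> S" using S x openE by blast
  have "\<exists>d>0. \<forall>y\<in>S. dist y x < d \<longrightarrow> dist (pd (pd f v) w y) (pd (pd f v) w x) < e" for v w
    using cont[of v w] x e unfolding continuous_on_iff by blast
  then obtain d1 d2 where d1: "d1 > 0" "\<And>y. y \<in> S \<Longrightarrow> dist y x < d1 \<Longrightarrow> \<bar>pd (pd f v) w y - pd (pd f v) w x\<bar> < e"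
    and d2: "d2 > 0" "\<And>y. y \<in> S \<Longrightarrow> dist y x < d2 \<Longrightarrow> \<bar>pd (pd f w) v y - pd (pd f w) v x\<bar> < e"
    unfolding dist_real_def by metis
  define d where "d = min d0 (min d1 d2)"
  have d: "d > 0" using d0 d1 d2 by (simp add: d_def)
  \<comment> \<open>So short a step keeps the whole parallelogram within distance \<open>d\<close>
    of \<open>x\<close>, where both derivatives are nearly constant.\<close>
  define s where "s = d / (2 * (norm v + norm w + 1))"
  have nz: "norm v + norm w + 1 > 0" by (simp add: add_nonneg_pos)
  have s: "s > 0" using d nz by (simp add: s_def)
  have ss: "s * (norm v + norm w) < d"
  proof -
    have "s * (norm v + norm w) \<le> s * (norm v + norm w + 1)" using s by simp
    also have "\<dots> = d / 2"
      unfolding s_def using nz by (metis less_irrefl nonzero_mult_divide_mult_cancel_right times_divide_eq_left)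
    finally show ?thesis using d by simp
  qed
  have near: "dist (x + a *\<^sub>R v + b *\<^sub>R w) x < d" if "a \<in> {0..s}" "b \<in> {0..s}" for a b
  proof -
    have "dist (x + a *\<^sub>R v + b *\<^sub>R w) x = norm (a *\<^sub>R v + b *\<^sub>R w)" by (simp add: dist_norm)
    also have "\<dots> \<le> a * norm v + b * norm w"
      using that by (intro norm_triangle_le) simp
    also have "\<dots> \<le> s * norm v + s * norm w" using that by (intro add_mono mult_right_mono) auto
    also have "\<dots> < d" using ss by (simp add: algebra_simps)
    finally show ?thesis .
  qed
  have inS: "x + a *\<^sub>R v + b *\<^sub>R w \<in> S" if "a \<in> {0..s}" "b \<in> {0..s}" for a b
    using near[OF that] d0 by (auto simp: d_def dist_commute)
  have comm: "x + a *\<^sub>R w + b *\<^sub>R v = x + b *\<^sub>R v + a *\<^sub>R w" for a b by (simp add: algebra_simps)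
  obtain a b where ab: "a \<in> {0..s}" "b \<in> {0..s}"
    "f (x + s *\<^sub>R v + s *\<^sub>R w) - f (x + s *\<^sub>R v) - f (x + s *\<^sub>R w) + f x
      = s\<^sup>2 * pd (pd f v) w (x + a *\<^sub>R v + b *\<^sub>R w)"
    using double_difference[OF S f s inS] by blast
  obtain a' b' where ab': "a' \<in> {0..s}" "b' \<in> {0..s}"
    "f (x + s *\<^sub>R w + s *\<^sub>R v) - f (x + s *\<^sub>R w) - f (x + s *\<^sub>R v) + f x
      = s\<^sup>2 * pd (pd f w) v (x + a' *\<^sub>R w + b' *\<^sub>R v)"
    using double_difference[OF S f s, of x w v] inS unfolding comm by blast
  have "s\<^sup>2 * pd (pd f v) w (x + a *\<^sub>R v + b *\<^sub>R w) = s\<^sup>2 * pd (pd f w) v (x + a' *\<^sub>R w + b' *\<^sub>R v)"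
    using ab(3) ab'(3)[unfolded comm[of s s]] by linarith
  then have "pd (pd f v) w (x + a *\<^sub>R v + b *\<^sub>R w) = pd (pd f w) v (x + a' *\<^sub>R w + b' *\<^sub>R v)"
    using s by simp
  moreover have "\<bar>pd (pd f v) w (x + a *\<^sub>R v + b *\<^sub>R w) - pd (pd f v) w x\<bar> < e"
    using d1(2) inS near ab by (simp add: d_def)
  moreover have "\<bar>pd (pd f w) v (x + a' *\<^sub>R w + b' *\<^sub>R v) - pd (pd f w) v x\<bar> < e"
    using d2(2) inS near ab' by (simp add: d_def comm)
  moreover have "False" if "p = q" "\<bar>p - y\<bar> < \<bar>y - z\<bar> / 2" "\<bar>q - z\<bar> < \<bar>y - z\<bar> / 2" for p q y z :: real
    using that by (smt (verit) field_sum_of_halves)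
  ultimately show False unfolding e_def by blast
qed

text \<open>Differentiability gives linearity in the outer direction; symmetry carries it over to
  the inner one, which is only a parameter of the function being differentiated.\<close>

lemma linear_pd_pd:
  fixes f :: "'a::real_normed_vector \<Rightarrow> real"
  assumes S: "open S" and f: "Ck_on (Suc (Suc 0)) S f" and x: "x \<in> S"
  shows "linear (\<lambda>v. pd (pd f v) w x)" "linear (\<lambda>w. pd (pd f v) w x)"
proof -
  have "linear (\<lambda>w. pd (pd f v) w x)" for v
    using Ck_on_differentiable[OF Ck_on_pd[OF f] S x] by (rule linear_pd)
  then show "linear (\<lambda>v. pd (pd f v) w x)" "linear (\<lambda>w. pd (pd f v) w x)"
    unfolding pd_symmetric[OF S f x, of _ w] by auto
qed

lemma pd3_symmetric:
  fixes f :: "'a::real_normed_vector \<Rightarrow> real"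
  assumes S: "open S" and f: "Ck_on (Suc (Suc (Suc 0))) S f" and x: "x \<in> S"
  shows "pd (pd (pd f v) w) z x = pd (pd (pd f w) v) z x"
    and "pd (pd (pd f v) w) z x = pd (pd (pd f v) z) w x"
proof -
  show "pd (pd (pd f v) w) z x = pd (pd (pd f w) v) z x"
    using pd_symmetric[OF S Ck_on_SucD[OF f]] Ck_on_differentiable[OF Ck_on_pd[OF Ck_on_pd[OF f]] S x]
    by (intro pd_cong[OF S x]) auto
  show "pd (pd (pd f v) w) z x = pd (pd (pd f v) z) w x"
    by (rule pd_symmetric[OF S Ck_on_pd[OF f] x])
qed

lemma linear_pd3:
  fixes f :: "'a::real_normed_vector \<Rightarrow> real"
  assumes S: "open S" and f: "Ck_on (Suc (Suc (Suc 0))) S f" and x: "x \<in> S"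
  shows "linear (\<lambda>v. pd (pd (pd f v) w) z x)" "linear (\<lambda>w. pd (pd (pd f v) w) z x)"
    "linear (\<lambda>z. pd (pd (pd f v) w) z x)"
proof -
  show *: "linear (\<lambda>z. pd (pd (pd f v) w) z x)" for v w
    using Ck_on_differentiable[OF Ck_on_pd[OF Ck_on_pd[OF f]] S x] by (rule linear_pd)
  show **: "linear (\<lambda>w. pd (pd (pd f v) w) z x)" for v z
    using linear_pd_pd(1)[OF S Ck_on_pd[OF f] x] .
  show "linear (\<lambda>v. pd (pd (pd f v) w) z x)"
    unfolding pd3_symmetric(1)[OF S f x, of _ w] by (rule **)
qed

section \<open>Scaling laws, Euler relations and the second derivative test\<close>

lemma pd_scale:
  fixes f :: "'a::real_normed_vector \<Rightarrow> real"
  assumes hom: "\<And>y. y \<noteq> 0 \<Longrightarrow> f (c *\<^sub>R y) = h * f y" and "c > 0" "x \<noteq> 0"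
    and d: "f differentiable (at x)" "f differentiable (at (c *\<^sub>R x))"
  shows "pd f w (c *\<^sub>R x) = h / c * pd f w x"
proof -
  have "((\<lambda>y. f (c *\<^sub>R y)) has_derivative (\<lambda>v. pd f (c *\<^sub>R v) (c *\<^sub>R x))) (at x)"
    by (rule has_derivative_compose[of "\<lambda>y. c *\<^sub>R y" _ _ _ f])
      (auto intro!: derivative_eq_intros has_derivative_pd d)
  moreover have "((\<lambda>y. h * f y) has_derivative (\<lambda>v. h * pd f v x)) (at x)"
    by (auto intro!: derivative_eq_intros has_derivative_pd d)
  then have "((\<lambda>y. f (c *\<^sub>R y)) has_derivative (\<lambda>v. h * pd f v x)) (at x)"
    by (rule has_derivative_transform_within_open[of _ _ _ _ "UNIV - {0}"]) (use hom \<open>x \<noteq> 0\<close> in auto)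
  ultimately have "pd f (c *\<^sub>R w) (c *\<^sub>R x) = h * pd f w x"
    by (metis has_derivative_unique)
  then show ?thesis using \<open>c > 0\<close> linear_scale[OF linear_pd[OF d(2)], of c w]
    by (simp add: field_simps)
qed

lemma pd_Euler:
  fixes f :: "'a::real_normed_vector \<Rightarrow> real"
  assumes hom: "\<And>c. c > 0 \<Longrightarrow> f (c *\<^sub>R x) = h c * f x"
    and d: "f differentiable (at x)" and h: "(h has_real_derivative h') (at 1)"
  shows "pd f x x = h' * f x"
proof (rule pd_eqI_line[OF d])
  have "((\<lambda>s. h (1 + s) * f x) has_real_derivative h' * f x) (at 0)"
    using DERIV_shift[of h h' 0 1] h by (intro DERIV_cmult_right) (simp add: add.commute)
  then show "((\<lambda>s. f (x + s *\<^sub>R x)) has_real_derivative h' * f x) (at 0)"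
  proof (rule DERIV_cong_ev[THEN iffD1, rotated 3])
    \<comment> \<open>Homogeneity is available for positive factors only, so the ray is used where 1
      + s > 0.\<close>
    have "\<forall>\<^sub>F s in nhds (0::real). s \<in> {-1<..}" by (intro eventually_nhds_in_open) auto
    then show "\<forall>\<^sub>F s in nhds 0. h (1 + s) * f x = f (x + s *\<^sub>R x)"
    proof eventually_elim
      case (elim s)
      then show ?case using hom[of "1 + s"] by (simp add: algebra_simps)
    qed
  qed auto
qed

lemma second_derivative_at_max:
  fixes g :: "real \<Rightarrow> real"
  assumes "e > 0" and g1: "\<And>s. \<bar>s\<bar> < e \<Longrightarrow> (g has_real_derivative g1 s) (at s)"
    and g2: "(g1 has_real_derivative g2) (at 0)" and max: "\<And>s. \<bar>s\<bar> < e \<Longrightarrow> g s \<le> g 0"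
  shows "g1 0 = 0" "g2 \<le> 0"
proof -
  show z: "g1 0 = 0"
    using DERIV_local_max[OF g1[of 0] \<open>e > 0\<close>] max \<open>e > 0\<close> by auto
  show "g2 \<le> 0"
  proof (rule ccontr)
    assume "\<not> g2 \<le> 0"
    then obtain d where d: "d > 0" "\<And>h. h > 0 \<Longrightarrow> h < d \<Longrightarrow> g1 0 < g1 h"
      using DERIV_pos_inc_right[OF g2] by auto
    define s where "s = min d e / 2"
    have s: "0 < s" "s < d" "s < e" using d \<open>e > 0\<close> by (auto simp: s_def)
    obtain r where "0 < r" "r < s" "g s - g 0 = (s - 0) * g1 r"
      using MVT2[OF s(1), of g g1] g1 s by (auto simp: abs_if split: if_splits)
    moreover have "g1 r > 0" using d(2)[of r] z s calculation by auto
    ultimately have "g s > g 0" using s by (smt (verit) mult_pos_pos)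
    then show False using max[of s] s by auto
  qed
qed

section \<open>Positive semidefinite forms\<close>

lemma quadratic_form_discriminant:
  fixes a b c :: real
  assumes "\<And>s t. 0 \<le> s\<^sup>2 * a + 2 * s * t * b + t\<^sup>2 * c"
  shows "b\<^sup>2 \<le> a * c"
proof (cases "c = 0")
  case True
  have a: "a \<ge> 0" using assms[of 1 0] by simp
  have "b = 0"
  proof (rule ccontr)
    assume "b \<noteq> 0"
    \<comment> \<open>With c = 0 and s = 1 the form is affine in t, and this t makes it equal to
      -1.\<close>
    then show False using assms[of 1 "- (a + 1) / (2 * b)"] True a by (simp add: field_simps)
  qed
  then show ?thesis using True by simp
next
  case False
  moreover have "c \<ge> 0" using assms[of 0 1] by simp
  ultimately have c: "c > 0" by simp
  \<comment> \<open>The pair (c, -b) is, up to scale, the minimiser of the form for fixed first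
    entry.\<close>
  have "0 \<le> c * (a * c - b\<^sup>2)"
    using assms[of c "- b"] by (simp add: power2_eq_square algebra_simps)
  then show ?thesis using c by (simp add: zero_le_mult_iff)
qed

definition quad :: "('n::finite \<Rightarrow> 'n \<Rightarrow> real) \<Rightarrow> ('n \<Rightarrow> real) \<Rightarrow> ('n \<Rightarrow> real) \<Rightarrow> real" where
  "quad g x y = (\<Sum>i\<in>UNIV. \<Sum>j\<in>UNIV. g i j * x i * y j)"

lemma quad_add_left: "quad g (\<lambda>i. x i + x' i) y = quad g x y + quad g x' y"
  by (simp add: quad_def algebra_simps sum.distrib)

lemma quad_add_right: "quad g x (\<lambda>i. y i + y' i) = quad g x y + quad g x y'"
  by (simp add: quad_def algebra_simps sum.distrib)

lemma quad_scale_left: "quad g (\<lambda>i. c * x i) y = c * quad g x y"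
  by (simp add: quad_def algebra_simps sum_distrib_left)

lemma quad_scale_right: "quad g x (\<lambda>i. c * y i) = c * quad g x y"
  by (simp add: quad_def algebra_simps sum_distrib_left)

lemma quad_commute: "(\<And>i j. g i j = g j i) \<Longrightarrow> quad g x y = quad g y x"
  unfolding quad_def by (subst sum.swap) (simp add: mult.assoc mult.left_commute mult.commute)

lemma quad_unit_left: "quad g (\<lambda>i. if i = m then 1 else 0) y = (\<Sum>j\<in>UNIV. g m j * y j)"
proof -
  have "quad g (\<lambda>i. if i = m then 1 else 0) y = (\<Sum>i\<in>UNIV. if i = m then \<Sum>j\<in>UNIV. g m j * y j else 0)"
    unfolding quad_def by (rule sum.cong) auto
  then show ?thesis by simp
qed

lemma quad_Cauchy_Schwarz:
  assumes sym: "\<And>i j. g i j = g j i" and psd: "\<And>x. 0 \<le> quad g x x"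
  shows "(quad g x y)\<^sup>2 \<le> quad g x x * quad g y y"
proof (rule quadratic_form_discriminant)
  fix s t
  have "quad g (\<lambda>i. s * x i + t * y i) (\<lambda>i. s * x i + t * y i)
      = s\<^sup>2 * quad g x x + 2 * s * t * quad g x y + t\<^sup>2 * quad g y y"
    using quad_commute[of g y x, OF sym]
    by (simp add: quad_add_left quad_add_right quad_scale_left quad_scale_right power2_eq_square algebra_simps)
  then show "0 \<le> s\<^sup>2 * quad g x x + 2 * s * t * quad g x y + t\<^sup>2 * quad g y y"
    using psd by metis
qed

text \<open>Cauchy-Schwarz for two unit vectors. In the elimination below it shows that a zero on
  the diagonal clears its whole row.\<close>

lemma psd_entry_le:
  assumes sym: "\<And>i j. g i j = g j i" and psd: "\<And>x. 0 \<le> quad g x x"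
  shows "(g i j)\<^sup>2 \<le> g i i * g j j"
proof -
  have "quad g (\<lambda>k. if k = a then 1 else 0) (\<lambda>k. if k = b then 1 else 0) = g a b" for a b
    by (simp add: quad_unit_left if_distrib cong: if_cong)
  then show ?thesis using quad_Cauchy_Schwarz[OF assms] by metis
qed

text \<open>Cholesky elimination: each step clears one diagonal entry.\<close>
lemma psd_decomposition_on:
  fixes g :: "'n::finite \<Rightarrow> 'n \<Rightarrow> real"
  assumes "finite S" and "\<And>i j. g i j = g j i" and "\<And>x. 0 \<le> quad g x x"
    and "\<And>i. g i i \<noteq> 0 \<Longrightarrow> i \<in> S"
  shows "\<exists>Z :: 'n \<Rightarrow> 'n \<Rightarrow> real. \<forall>i j. g i j = (\<Sum>m\<in>S. Z m i * Z m j)"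
  using assms
proof (induction S arbitrary: g rule: finite_induct)
  case empty
  then have "g i j = 0" for i j using psd_entry_le[of g i j] by force
  then show ?case by simp
next
  case (insert m S)
  note sym = insert.prems(1) and psd = insert.prems(2)
  show ?case
  proof (cases "g m m = 0")
    case True
    then obtain Z where Z: "\<forall>i j. g i j = (\<Sum>m\<in>S. Z m i * Z m j)"
      using insert.IH[OF sym psd] insert.prems(3) by blast
    have "g i j = (\<Sum>k\<in>insert m S. (Z(m := \<lambda>_. 0)) k i * (Z(m := \<lambda>_. 0)) k j)" for i j
    proof -
      have "(\<Sum>k\<in>S. (Z(m := \<lambda>_. 0)) k i * (Z(m := \<lambda>_. 0)) k j) = (\<Sum>k\<in>S. Z k i * Z k j)"
        by (rule sum.cong) (use insert.hyps in auto)
      then show ?thesis using insert.hyps Z by simp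
    qed
    then show ?thesis by blast
  next
    case False
    have "g m m \<ge> 0" using psd[of "\<lambda>i. if i = m then 1 else 0"]
      by (simp add: quad_unit_left if_distrib cong: if_cong)
    then have pos: "g m m > 0" using False by simp
    \<comment> \<open>Schur complement of the pivot \<open>g m m\<close>.\<close>
    define g' where "g' i j = g i j - g m i * g m j / g m m" for i j
    have "\<exists>Z. \<forall>i j. g' i j = (\<Sum>m\<in>S. Z m i * Z m j)"
    proof (rule insert.IH)
      show "g' i j = g' j i" for i j using sym by (simp add: g'_def mult.commute)
    next
      fix x
      \<comment> \<open>Cauchy-Schwarz between the unit vector at \<open>m\<close> and
        \<open>x\<close> is exactly the nonnegativity of the Schur complement.\<close>
      have "(quad g (\<lambda>i. if i = m then 1 else 0) x)\<^sup>2 \<le> g m m * quad g x x"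
        using quad_Cauchy_Schwarz[OF sym psd, of "\<lambda>i. if i = m then 1 else 0" x]
        by (simp add: quad_unit_left if_distrib cong: if_cong)
      then have "(\<Sum>j\<in>UNIV. g m j * x j)\<^sup>2 / g m m \<le> quad g x x"
        using pos by (simp add: quad_unit_left divide_le_eq mult.commute)
      moreover have "quad g' x x = quad g x x - (\<Sum>j\<in>UNIV. g m j * x j)\<^sup>2 / g m m"
        unfolding quad_def g'_def
        by (simp add: left_diff_distrib right_diff_distrib sum_subtractf power2_eq_square sum_product
            sum_divide_distrib ac_simps)
      ultimately show "0 \<le> quad g' x x" by simp
    next
      fix i assume i: "g' i i \<noteq> 0"
      \<comment> \<open>Elimination creates no new nonzero diagonal entry and clears the one at
        \<open>m\<close>, so the support shrinks to \<open>S\<close>.\<close>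
      have "g i i \<noteq> 0"
      proof
        assume 0: "g i i = 0"
        then have "g m i = 0" using psd_entry_le[OF sym psd, of m i] by simp
        then show False using i 0 by (simp add: g'_def)
      qed
      then have "i \<in> insert m S" by (rule insert.prems(3))
      moreover have "i \<noteq> m" using i pos by (auto simp: g'_def)
      ultimately show "i \<in> S" by simp
    qed
    then obtain Z where Z: "\<And>i j. g' i j = (\<Sum>m\<in>S. Z m i * Z m j)" by blast
    define Z' where "Z' = Z(m := \<lambda>i. g m i / sqrt (g m m))"
    have "g i j = (\<Sum>k\<in>insert m S. Z' k i * Z' k j)" for i j
    proof -
      have "(\<Sum>k\<in>insert m S. Z' k i * Z' k j) = Z' m i * Z' m j + (\<Sum>k\<in>S. Z' k i * Z' k j)"
        using insert.hyps by simp
      also have "(\<Sum>k\<in>S. Z' k i * Z' k j) = g' i j"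
        unfolding Z by (rule sum.cong) (use insert.hyps in \<open>auto simp: Z'_def\<close>)
      also have "Z' m i * Z' m j = g m i * g m j / g m m"
        using pos by (simp add: Z'_def)
      finally show ?thesis by (simp add: g'_def)
    qed
    then show ?thesis by blast
  qed
qed

text \<open>A factorisation g = Z^T Z takes the place of diagonalisation: the rows of Z serve as
  directions along which a g-trace becomes a plain sum of second derivatives.\<close>

lemma psd_decomposition:
  fixes g :: "'n::finite \<Rightarrow> 'n \<Rightarrow> real"
  assumes "\<And>i j. g i j = g j i" and "\<And>x. 0 \<le> quad g x x"
  shows "\<exists>Z :: 'n \<Rightarrow> 'n \<Rightarrow> real. \<forall>i j. g i j = (\<Sum>m\<in>UNIV. Z m i * Z m j)"
  by (rule psd_decomposition_on) (use assms in simp_all)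

lemma quad_decomposition:
  fixes g :: "'n::finite \<Rightarrow> 'n \<Rightarrow> real"
  assumes Z: "\<And>i j. g i j = (\<Sum>m\<in>UNIV. Z m i * Z m j)"
  shows "quad g x y = (\<Sum>m\<in>UNIV. (\<Sum>i\<in>UNIV. Z m i * x i) * (\<Sum>j\<in>UNIV. Z m j * y j))"
proof -
  have "quad g x y = (\<Sum>i\<in>UNIV. \<Sum>j\<in>UNIV. \<Sum>m\<in>UNIV. (Z m i * x i) * (Z m j * y j))"
    unfolding quad_def Z by (simp add: sum_distrib_right mult.assoc mult.left_commute)
  also have "\<dots> = (\<Sum>i\<in>UNIV. \<Sum>m\<in>UNIV. \<Sum>j\<in>UNIV. (Z m i * x i) * (Z m j * y j))"
    by (rule sum.cong[OF refl], subst sum.swap, rule refl)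
  also have "\<dots> = (\<Sum>m\<in>UNIV. \<Sum>i\<in>UNIV. \<Sum>j\<in>UNIV. (Z m i * x i) * (Z m j * y j))"
    by (rule sum.swap)
  finally show ?thesis by (simp add: sum_product)
qed

section \<open>The trace pairing and the trace of (g h)^2\<close>

definition pairing :: "('n::finite \<Rightarrow> 'n \<Rightarrow> real) \<Rightarrow> ('n \<Rightarrow> 'n \<Rightarrow> real) \<Rightarrow> real" where
  "pairing g h = (\<Sum>i\<in>UNIV. \<Sum>j\<in>UNIV. g i j * h i j)"

text \<open>This is tr(g h g h). For symmetric h and g = Z^T Z it is the squared Frobenius norm of Z
  h Z^T.\<close>

definition trace_sq :: "('n::finite \<Rightarrow> 'n \<Rightarrow> real) \<Rightarrow> ('n \<Rightarrow> 'n \<Rightarrow> real) \<Rightarrow> real" where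
  "trace_sq g h = (\<Sum>i\<in>UNIV. \<Sum>j\<in>UNIV. (\<Sum>k\<in>UNIV. g i k * h k j) * (\<Sum>l\<in>UNIV. g j l * h l i))"

lemma pairing_decomposition:
  assumes Z: "\<And>i j. g i j = (\<Sum>m\<in>UNIV. Z m i * Z m j)"
  shows "pairing g h = (\<Sum>m\<in>UNIV. quad h (Z m) (Z m))"
proof -
  have "pairing g h = (\<Sum>i\<in>UNIV. \<Sum>j\<in>UNIV. \<Sum>m\<in>UNIV. h i j * Z m i * Z m j)"
    unfolding pairing_def Z by (simp add: sum_distrib_left sum_distrib_right ac_simps)
  also have "\<dots> = (\<Sum>i\<in>UNIV. \<Sum>m\<in>UNIV. \<Sum>j\<in>UNIV. h i j * Z m i * Z m j)"
    by (rule sum.cong[OF refl], subst sum.swap, rule refl)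
  also have "\<dots> = (\<Sum>m\<in>UNIV. quad h (Z m) (Z m))"
    unfolding quad_def by (rule sum.swap)
  finally show ?thesis .
qed

text \<open>The trace of g h g h is that of Z h g h Z^T, whose diagonal entries are the values of g
  on the vectors h Z_m.\<close>

lemma trace_sq_decomposition:
  assumes Z: "\<And>i j. g i j = (\<Sum>m\<in>UNIV. Z m i * Z m j)" and h: "\<And>i j. h i j = h j i"
  shows "trace_sq g h = (\<Sum>m\<in>UNIV. quad g (\<lambda>i. \<Sum>j\<in>UNIV. h i j * Z m j) (\<lambda>i. \<Sum>j\<in>UNIV. h i j * Z m j))"
proof -
  define w where "w m i = (\<Sum>j\<in>UNIV. h i j * Z m j)" for m i
  have hg: "(\<Sum>k\<in>UNIV. g i k * h k j) = (\<Sum>m\<in>UNIV. Z m i * w m j)" for i j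
  proof -
    have "(\<Sum>k\<in>UNIV. g i k * h k j) = (\<Sum>k\<in>UNIV. \<Sum>m\<in>UNIV. Z m i * (h j k * Z m k))"
      unfolding Z h[of _ j] by (simp add: sum_distrib_left sum_distrib_right ac_simps)
    also have "\<dots> = (\<Sum>m\<in>UNIV. \<Sum>k\<in>UNIV. Z m i * (h j k * Z m k))" by (rule sum.swap)
    finally show ?thesis by (simp add: w_def sum_distrib_left)
  qed
  have "trace_sq g h = (\<Sum>i\<in>UNIV. \<Sum>j\<in>UNIV. \<Sum>m\<in>UNIV. Z m i * w m j * (\<Sum>l\<in>UNIV. g j l * h l i))"
    unfolding trace_sq_def hg[of _ _, symmetric] sum_distrib_right[symmetric] ..
  also have "\<dots> = (\<Sum>i\<in>UNIV. \<Sum>m\<in>UNIV. \<Sum>j\<in>UNIV. Z m i * w m j * (\<Sum>l\<in>UNIV. g j l * h l i))"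
    by (rule sum.cong[OF refl], subst sum.swap, rule refl)
  also have "\<dots> = (\<Sum>m\<in>UNIV. \<Sum>i\<in>UNIV. \<Sum>j\<in>UNIV. Z m i * w m j * (\<Sum>l\<in>UNIV. g j l * h l i))"
    by (rule sum.swap)
  also have "\<dots> = (\<Sum>m\<in>UNIV. quad g (w m) (w m))"
  proof (rule sum.cong[OF refl])
    fix m
    have "(\<Sum>i\<in>UNIV. \<Sum>j\<in>UNIV. Z m i * w m j * (\<Sum>l\<in>UNIV. g j l * h l i))
      = (\<Sum>j\<in>UNIV. \<Sum>i\<in>UNIV. \<Sum>l\<in>UNIV. g j l * w m j * (h l i * Z m i))"
      by (subst sum.swap) (simp add: sum_distrib_left mult.assoc mult.left_commute mult.commute)
    also have "\<dots> = (\<Sum>j\<in>UNIV. \<Sum>l\<in>UNIV. \<Sum>i\<in>UNIV. g j l * w m j * (h l i * Z m i))"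
      by (rule sum.cong[OF refl], subst sum.swap, rule refl)
    also have "\<dots> = quad g (w m) (w m)"
      by (simp add: quad_def sum_distrib_left[symmetric] w_def)
    finally show "(\<Sum>i\<in>UNIV. \<Sum>j\<in>UNIV. Z m i * w m j * (\<Sum>l\<in>UNIV. g j l * h l i)) = quad g (w m) (w m)" .
  qed
  finally show ?thesis unfolding w_def .
qed

lemma trace_sq_nonneg:
  fixes g :: "'n::finite \<Rightarrow> 'n \<Rightarrow> real"
  assumes g: "\<And>i j. g i j = g j i" "\<And>x. 0 \<le> quad g x x" and h: "\<And>i j. h i j = h j i"
  shows "0 \<le> trace_sq g h"
proof -
  from psd_decomposition[OF g] obtain Z :: "'n \<Rightarrow> 'n \<Rightarrow> real" where "\<forall>i j. g i j = (\<Sum>m\<in>UNIV. Z m i * Z m j)" ..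
  then have "g i j = (\<Sum>m\<in>UNIV. Z m i * Z m j)" for i j by simp
  from trace_sq_decomposition[of g Z h, OF this h] show ?thesis by (simp add: sum_nonneg g(2))
qed

text \<open>Since \<open>g\<close> is semidefinite, the trace of \<open>(g h)\<^sup>2\<close> vanishes only if \<open>g h g = 0\<close>.\<close>
lemma trace_sq_zero_imp_null:
  fixes g :: "'n::finite \<Rightarrow> 'n \<Rightarrow> real"
  assumes g: "\<And>i j. g i j = g j i" "\<And>x. 0 \<le> quad g x x" and h: "\<And>i j. h i j = h j i"
    and zero: "trace_sq g h = 0"
  defines "x \<equiv> \<lambda>w i. \<Sum>k\<in>UNIV. h i k * (\<Sum>l\<in>UNIV. g k l * w l)"
  shows "quad g (x w) (x w) = 0"
proof -
  from psd_decomposition[OF g] obtain Z :: "'n \<Rightarrow> 'n \<Rightarrow> real" where "\<forall>i j. g i j = (\<Sum>m\<in>UNIV. Z m i * Z m j)" ..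
  then have Z: "g i j = (\<Sum>m\<in>UNIV. Z m i * Z m j)" for i j by simp
  define y where "y m i = (\<Sum>j\<in>UNIV. h i j * Z m j)" for m i
  have "(\<Sum>m\<in>UNIV. quad g (y m) (y m)) = 0"
    using trace_sq_decomposition[of g Z h, OF Z h] zero by (simp add: y_def[abs_def])
  then have y0: "quad g (y m) (y m) = 0" for m
    by (subst (asm) sum_nonneg_eq_0_iff) (simp_all add: g(2))
  \<comment> \<open>The form of g is the sum of the squares of the functionals given by the rows of
    Z, so each row annihilates every null vector.\<close>
  then have Zy: "(\<Sum>i\<in>UNIV. Z m' i * y m i) = 0" for m m'
  proof -
    have "(\<Sum>m'\<in>UNIV. (\<Sum>i\<in>UNIV. Z m' i * y m i) * (\<Sum>i\<in>UNIV. Z m' i * y m i)) = 0"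
      using quad_decomposition[of g Z "y m" "y m", OF Z] y0[of m] by simp
    then have "(\<Sum>i\<in>UNIV. Z m' i * y m i) * (\<Sum>i\<in>UNIV. Z m' i * y m i) = 0"
      by (subst (asm) sum_nonneg_eq_0_iff) simp_all
    then show ?thesis by simp
  qed
  define c where "c m = (\<Sum>l\<in>UNIV. Z m l * w l)" for m
  \<comment> \<open>The vector g w lies in the span of the rows of Z, so h g w is a combination of
    the null vectors \<open>y m\<close>.\<close>
  have xw: "x w i = (\<Sum>m\<in>UNIV. c m * y m i)" for i
  proof -
    have gw: "(\<Sum>l\<in>UNIV. g k l * w l) = (\<Sum>m\<in>UNIV. Z m k * c m)" for k
    proof -
      have "(\<Sum>l\<in>UNIV. g k l * w l) = (\<Sum>l\<in>UNIV. \<Sum>m\<in>UNIV. Z m k * (Z m l * w l))"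
        unfolding Z by (simp add: sum_distrib_right mult.assoc)
      also have "\<dots> = (\<Sum>m\<in>UNIV. \<Sum>l\<in>UNIV. Z m k * (Z m l * w l))" by (rule sum.swap)
      finally show ?thesis by (simp add: c_def sum_distrib_left)
    qed
    have "x w i = (\<Sum>k\<in>UNIV. \<Sum>m\<in>UNIV. c m * (h i k * Z m k))"
      unfolding x_def gw by (simp add: sum_distrib_left ac_simps)
    also have "\<dots> = (\<Sum>m\<in>UNIV. \<Sum>k\<in>UNIV. c m * (h i k * Z m k))" by (rule sum.swap)
    finally show ?thesis by (simp add: sum_distrib_left y_def)
  qed
  have "(\<Sum>i\<in>UNIV. Z m' i * x w i) = 0" for m'
  proof -
    have "(\<Sum>i\<in>UNIV. Z m' i * x w i) = (\<Sum>i\<in>UNIV. \<Sum>m\<in>UNIV. c m * (Z m' i * y m i))"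
      by (simp add: xw sum_distrib_left ac_simps)
    also have "\<dots> = (\<Sum>m\<in>UNIV. \<Sum>i\<in>UNIV. c m * (Z m' i * y m i))" by (rule sum.swap)
    also have "\<dots> = 0" by (simp add: sum_distrib_left[symmetric] Zy)
    finally show ?thesis .
  qed
  then show ?thesis by (simp add: quad_decomposition[of g Z, OF Z])
qed

lemma pairing_rank_one_add:
  "pairing g (\<lambda>i j. s * (e i * e j) + k i j) = s * quad g e e + pairing g k"
  by (simp add: pairing_def quad_def algebra_simps sum.distrib sum_distrib_left)

text \<open>With y = g e and N = g k, the product of g with the sum is s y e^T + N. Both mixed terms
  of its squared trace are s y^T k y, because e^T N = y^T k.\<close>

lemma trace_sq_rank_one_add:
  assumes g: "\<And>i j. g i j = g j i" and k: "\<And>i j. k i j = k j i"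
    and y: "\<And>i. y i = (\<Sum>j\<in>UNIV. g i j * e j)"
  shows "trace_sq g (\<lambda>i j. s * (e i * e j) + k i j)
    = s\<^sup>2 * (quad g e e)\<^sup>2 + 2 * s * quad k y y + trace_sq g k"
proof -
  define N where "N i j = (\<Sum>l\<in>UNIV. g i l * k l j)" for i j
  have M: "(\<Sum>l\<in>UNIV. g i l * (s * (e l * e j) + k l j)) = s * y i * e j + N i j" for i j
    by (simp add: N_def y algebra_simps sum.distrib sum_distrib_left)
  have yN: "(\<Sum>i\<in>UNIV. e i * N i j) = (\<Sum>i\<in>UNIV. k j i * y i)" for j
  proof -
    have "(\<Sum>i\<in>UNIV. e i * N i j) = (\<Sum>i\<in>UNIV. \<Sum>l\<in>UNIV. k j l * (g l i * e i))"
      by (intro sum.cong refl)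
        (auto simp: N_def sum_distrib_left k[of j] g[of i for i] ac_simps intro!: sum.cong)
    also have "\<dots> = (\<Sum>l\<in>UNIV. \<Sum>i\<in>UNIV. k j l * (g l i * e i))" by (rule sum.swap)
    finally show ?thesis by (simp add: y sum_distrib_left)
  qed
  have yy: "(\<Sum>i\<in>UNIV. y i * e i) = quad g e e"
    by (simp add: y quad_def sum_distrib_left mult.assoc mult.left_commute mult.commute)
  have kyy: "(\<Sum>j\<in>UNIV. \<Sum>i\<in>UNIV. y j * (e i * N i j)) = quad k y y"
    by (simp add: sum_distrib_left[symmetric] yN)
      (simp add: quad_def sum_distrib_left mult.assoc mult.left_commute mult.commute)
  have "trace_sq g (\<lambda>i j. s * (e i * e j) + k i j)
     = (\<Sum>i\<in>UNIV. \<Sum>j\<in>UNIV. (s * y i * e j + N i j) * (s * y j * e i + N j i))"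
    by (simp add: trace_sq_def M)
  also have "\<dots> = (\<Sum>i\<in>UNIV. \<Sum>j\<in>UNIV. s\<^sup>2 * ((y i * e i) * (y j * e j)) + s * (y i * (e j * N j i))
      + s * (y j * (e i * N i j)) + N i j * N j i)"
    by (intro sum.cong refl) (simp add: power2_eq_square algebra_simps)
  also have "\<dots> = s\<^sup>2 * ((\<Sum>i\<in>UNIV. y i * e i) * (\<Sum>j\<in>UNIV. y j * e j))
      + s * (\<Sum>i\<in>UNIV. \<Sum>j\<in>UNIV. y i * (e j * N j i)) + s * (\<Sum>i\<in>UNIV. \<Sum>j\<in>UNIV. y j * (e i * N i j))
      + trace_sq g k"
    unfolding sum_product trace_sq_def N_def[symmetric] by (simp add: sum.distrib sum_distrib_left)
  also have "(\<Sum>i\<in>UNIV. \<Sum>j\<in>UNIV. y j * (e i * N i j)) = quad k y y"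
    by (subst sum.swap) (rule kyy)
  finally show ?thesis unfolding yy kyy by (simp add: power2_eq_square)
qed

section \<open>Homogeneous integrands\<close>

lemma linear_horizontal_expansion:
  fixes f :: "(real^'n) \<times> real \<Rightarrow> real"
  assumes "linear f"
  shows "f (x, 0) = (\<Sum>i\<in>UNIV. x $ i * f (phi i))"
proof -
  have "(x, 0) = (\<Sum>i\<in>UNIV. x $ i *\<^sub>R phi i)"
    by (simp add: phi_def prod_eq_iff fst_sum snd_sum vec_eq_iff axis_def if_distrib cong: if_cong)
  then show ?thesis by (simp add: linear_sum[OF assms] linear_scale[OF assms])
qed

text \<open>Differentiating horizontally commutes with the reflection. Iterated, this makes the
  horizontal second derivatives of F even, so \<open>pd_vertical_eq_0\<close> applies to them and B
  vanishes on the equator.\<close>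

lemma pd_reflection:
  fixes f :: "(real^'n) \<times> real \<Rightarrow> real"
  assumes even: "\<And>p s. f (p, s) = f (p, - s)" and d: "\<And>x. x \<noteq> 0 \<Longrightarrow> f differentiable (at x)"
  shows "pd f (a, 0) (p, s) = pd f (a, 0) (p, - s)"
proof (cases "(p, s) = 0")
  case True
  then show ?thesis by (simp add: prod_eq_iff)
next
  case False
  show ?thesis
  proof (rule pd_eqI_line)
    show "f differentiable (at (p, s))" using d False by blast
    have "((\<lambda>t. f ((p, - s) + t *\<^sub>R (a, 0))) has_real_derivative pd f (a, 0) ((p, - s) + 0 *\<^sub>R (a, 0))) (at 0)"
      using False by (intro pd_line d) (auto simp: prod_eq_iff)
    moreover have "f ((p, - s) + t *\<^sub>R (a, 0)) = f ((p, s) + t *\<^sub>R (a, 0))" for t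
      using even[of "p + t *\<^sub>R a" s] by simp
    ultimately show "((\<lambda>t. f ((p, s) + t *\<^sub>R (a, 0))) has_real_derivative pd f (a, 0) (p, - s)) (at 0)"
      by simp
  qed
qed

lemma pd_vertical_eq_0:
  fixes f :: "(real^'n) \<times> real \<Rightarrow> real"
  assumes even: "\<And>p s. f (p, s) = f (p, - s)" and d: "f differentiable (at (p, 0))"
  shows "pd f (0, 1) (p, 0) = 0"
proof -
  define D where "D = pd f (0, 1) (p, 0)"
  have *: "((\<lambda>t. f (p, t)) has_real_derivative D) (at 0)"
    using pd_line[of f "(p, 0)" 0 "(0, 1)" UNIV] d by (simp add: D_def)
  have "((\<lambda>t. f (p, - t)) has_real_derivative - D) (at 0)"
    using * DERIV_mirror[of "\<lambda>t. f (p, t)" D 0] by simp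
  then have "((\<lambda>t. f (p, t)) has_real_derivative - D) (at 0)"
    by (simp only: even[symmetric])
  with * have "D = - D" by (rule DERIV_unique)
  then show ?thesis by (simp add: D_def)
qed

section \<open>Regularity, evenness and homogeneity of F\<close>

locale anisotropy =
  fixes F :: "(real^'n) \<times> real \<Rightarrow> real"
  assumes standing: "standing_assumptions F" and symmetric: "SYM F"
begin

lemma F_pos: "x \<noteq> 0 \<Longrightarrow> F x > 0"
  and F_hom: "c > 0 \<Longrightarrow> F (c *\<^sub>R x) = c * F x"
  and F_convex: "convex_on UNIV F"
  and F_C3: "Ck_on (Suc (Suc (Suc 0))) (UNIV - {0}) F"
  and F_uniform: "uniformly_convex_set {v. F v \<le> c}"
  using standing unfolding standing_assumptions_def numeral_3_eq_3 by blast+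

abbreviation "\<Omega> \<equiv> UNIV - {0 :: (real^'n) \<times> real}"

lemma open_Omega: "open \<Omega>" by auto

text \<open>\<open>SYM\<close> speaks of height one only; homogeneity carries it to every positive
  height, and height zero is trivial.\<close>

lemma F_even: "F (p, s) = F (p, - s)"
proof -
  have *: "F (p, s) = F (p, - s)" if "s > 0" for p s
  proof -
    have "F ((1 / s) *\<^sub>R p, 1) = F ((1 / s) *\<^sub>R p, - 1)"
      using symmetric by (simp add: SYM_def phi0_def)
    then have "F (s *\<^sub>R ((1 / s) *\<^sub>R p, 1)) = F (s *\<^sub>R ((1 / s) *\<^sub>R p, - 1))"
      by (simp only: F_hom[OF that])
    then show ?thesis using that by simp
  qed
  show ?thesis using *[of s p] *[of "- s" p] by (cases s "0 :: real" rule: linorder_cases) auto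
qed

lemma F_diff: "x \<noteq> 0 \<Longrightarrow> F differentiable (at x)"
  and F_diff2: "x \<noteq> 0 \<Longrightarrow> pd F v differentiable (at x)"
  and F_diff3: "x \<noteq> 0 \<Longrightarrow> pd (pd F v) w differentiable (at x)"
  using Ck_on_differentiable[OF F_C3 open_Omega] Ck_on_differentiable[OF Ck_on_pd[OF F_C3] open_Omega]
    Ck_on_differentiable[OF Ck_on_pd[OF Ck_on_pd[OF F_C3]] open_Omega] by blast+

lemma cont_F: "continuous_on \<Omega> F"
  and cont_dF: "continuous_on \<Omega> (pd F v)"
  and cont_d2F: "continuous_on \<Omega> (pd (pd F v) w)"
  and cont_d3F: "continuous_on \<Omega> (pd (pd (pd F v) w) z)"
proof -
  show "continuous_on \<Omega> F" "continuous_on \<Omega> (pd F v)" "continuous_on \<Omega> (pd (pd F v) w)"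
    by (auto intro!: continuous_at_imp_continuous_on differentiable_imp_continuous_within F_diff F_diff2 F_diff3)
  show "continuous_on \<Omega> (pd (pd (pd F v) w) z)"
    using Ck_on_pd[OF Ck_on_pd[OF Ck_on_pd[OF F_C3]]] by simp
qed

lemma linear_dF: "x \<noteq> 0 \<Longrightarrow> linear (\<lambda>v. pd F v x)"
  by (rule linear_pd[OF F_diff])

lemma linear_d2F:
  assumes "x \<noteq> 0"
  shows "linear (\<lambda>v. pd (pd F v) w x)" "linear (\<lambda>w. pd (pd F v) w x)"
  using linear_pd_pd[OF open_Omega Ck_on_SucD[OF F_C3]] assms by auto

lemma linear_d3F:
  assumes "x \<noteq> 0"
  shows "linear (\<lambda>v. pd (pd (pd F v) w) z x)" "linear (\<lambda>w. pd (pd (pd F v) w) z x)"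
    "linear (\<lambda>z. pd (pd (pd F v) w) z x)"
  using linear_pd3[OF open_Omega F_C3] assms by auto

lemma d2F_sym: "x \<noteq> 0 \<Longrightarrow> pd (pd F v) w x = pd (pd F w) v x"
  using pd_symmetric[OF open_Omega Ck_on_SucD[OF F_C3]] by auto

lemma d3F_sym:
  assumes "x \<noteq> 0"
  shows "pd (pd (pd F v) w) z x = pd (pd (pd F w) v) z x"
    and "pd (pd (pd F v) w) z x = pd (pd (pd F v) z) w x"
  using pd3_symmetric[OF open_Omega F_C3] assms by auto

lemma dF_hom: "c > 0 \<Longrightarrow> x \<noteq> 0 \<Longrightarrow> pd F v (c *\<^sub>R x) = pd F v x"
  using pd_scale[of F c c x v] by (simp add: F_hom F_diff)

lemma d2F_hom: "c > 0 \<Longrightarrow> x \<noteq> 0 \<Longrightarrow> pd (pd F v) w (c *\<^sub>R x) = 1 / c * pd (pd F v) w x"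
  using pd_scale[of "pd F v" c 1 x w] by (simp add: dF_hom F_diff2)

lemma d3F_hom: "c > 0 \<Longrightarrow> x \<noteq> 0 \<Longrightarrow> pd (pd (pd F v) w) z (c *\<^sub>R x) = 1 / c\<^sup>2 * pd (pd (pd F v) w) z x"
  using pd_scale[of "pd (pd F v) w" c "1 / c" x z] by (simp add: d2F_hom F_diff3 power2_eq_square)

lemma Euler1: "x \<noteq> 0 \<Longrightarrow> pd F x x = F x"
  using pd_Euler[of F x "\<lambda>c. c" 1] by (simp add: F_hom F_diff)

lemma Euler2: "x \<noteq> 0 \<Longrightarrow> pd (pd F v) x x = 0"
  using pd_Euler[of "pd F v" x "\<lambda>c. 1" 0] by (simp add: dF_hom F_diff2)

lemma Euler3: "x \<noteq> 0 \<Longrightarrow> pd (pd (pd F v) w) x x = - pd (pd F v) w x"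
proof -
  assume x: "x \<noteq> 0"
  have "((\<lambda>c::real. 1 / c) has_real_derivative - 1) (at 1)"
    by (auto intro!: derivative_eq_intros)
  from pd_Euler[OF _ _ this, of "pd (pd F v) w" x] x show ?thesis by (simp add: d2F_hom F_diff3)
qed

lemma dF_vertical: "e \<noteq> 0 \<Longrightarrow> pd F phi0 (e, 0) = 0"
  unfolding phi0_def by (rule pd_vertical_eq_0[OF F_even]) (simp add: F_diff prod_eq_iff)

lemma d3F_vertical: "e \<noteq> 0 \<Longrightarrow> pd (pd (pd F (phi i)) (phi j)) phi0 (e, 0) = 0"
  unfolding phi0_def phi_def
  by (intro pd_vertical_eq_0 pd_reflection F_even F_diff F_diff2 F_diff3) (simp_all add: prod_eq_iff)

section \<open>Positivity of the Hessian of F off the radial direction\<close>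

lemma line_nonzero:
  fixes x w :: "(real^'n) \<times> real"
  assumes "x \<noteq> 0"
  obtains e where "e > 0" "\<And>s. \<bar>s\<bar> < e \<Longrightarrow> x + s *\<^sub>R w \<noteq> 0"
proof
  define e where "e = norm x / (norm w + 1)"
  show "e > 0" using assms by (simp add: e_def add_nonneg_pos)
  show "x + s *\<^sub>R w \<noteq> 0" if "\<bar>s\<bar> < e" for s
  proof
    assume "x + s *\<^sub>R w = 0"
    then have "norm x = \<bar>s\<bar> * norm w" by (metis add_eq_0_iff norm_minus_cancel norm_scaleR add.commute)
    also have "\<dots> \<le> \<bar>s\<bar> * (norm w + 1)" by (simp add: mult_left_mono)
    also have "\<dots> < e * (norm w + 1)" using that by (intro mult_strict_right_mono) (auto simp: add_nonneg_pos)
    also have "\<dots> = norm x" unfolding e_def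
      using norm_ge_zero[of w] by (simp add: field_simps add_nonneg_eq_0_iff)
    finally show False by simp
  qed
qed

lemma supporting_plane:
  assumes "x \<noteq> 0"
  shows "F x + pd F w x \<le> F (x + w)"
proof -
  have "convex_on UNIV (\<lambda>s. F (x + s *\<^sub>R w))"
  proof (rule convex_onI)
    fix t a b :: real assume t: "0 < t" "t < 1"
    have "x + ((1 - t) *\<^sub>R a + t *\<^sub>R b) *\<^sub>R w = (1 - t) *\<^sub>R (x + a *\<^sub>R w) + t *\<^sub>R (x + b *\<^sub>R w)"
      by (simp add: algebra_simps)
    then show "F (x + ((1 - t) *\<^sub>R a + t *\<^sub>R b) *\<^sub>R w) \<le> (1 - t) * F (x + a *\<^sub>R w) + t * F (x + b *\<^sub>R w)"
      using convex_onD[OF F_convex, of t "x + a *\<^sub>R w" "x + b *\<^sub>R w"] t by simp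
  qed simp
  moreover have "((\<lambda>s. F (x + s *\<^sub>R w)) has_real_derivative pd F w x) (at 0 within UNIV)"
    using pd_line[of F x 0 w UNIV] F_diff[OF assms] by simp
  ultimately have "F (x + 1 *\<^sub>R w) - F (x + 0 *\<^sub>R w) \<ge> pd F w x * (1 - 0)"
    by (intro convex_on_imp_above_tangent[of UNIV]) auto
  then show ?thesis by simp
qed

text \<open>The tangent line minus F along direction \<open>w\<close> has its maximum at
  \<open>x\<close> by \<open>supporting_plane\<close>, so its second derivative there is at most
  0.\<close>

lemma d2F_nonneg:
  assumes "x \<noteq> 0"
  shows "0 \<le> pd (pd F w) w x"
proof -
  obtain e where e: "e > 0" "\<And>s. \<bar>s\<bar> < e \<Longrightarrow> x + s *\<^sub>R w \<noteq> 0" using line_nonzero[OF assms] by blast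
  have "- pd (pd F w) w x \<le> 0"
  proof (rule second_derivative_at_max(2)[OF e(1)])
    fix s :: real assume s: "\<bar>s\<bar> < e"
    show "((\<lambda>s. F x + s * pd F w x - F (x + s *\<^sub>R w)) has_real_derivative pd F w x - pd F w (x + s *\<^sub>R w)) (at s)"
      by (auto intro!: derivative_eq_intros pd_line F_diff e(2) s)
    show "F x + s * pd F w x - F (x + s *\<^sub>R w) \<le> F x + 0 * pd F w x - F (x + 0 *\<^sub>R w)"
      using supporting_plane[OF assms, of "s *\<^sub>R w"] linear_scale[OF linear_dF[OF assms]] by simp
  next
    show "((\<lambda>s. pd F w x - pd F w (x + s *\<^sub>R w)) has_real_derivative - pd (pd F w) w x) (at 0)"
      using pd_line[of "pd F w" x 0 w UNIV] F_diff2[OF assms] by (auto intro!: derivative_eq_intros)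
  qed
  then show ?thesis by simp
qed

end

text \<open>The hypotheses give g1(s) = o(s), and the mean value bound integrates this. Only
  differentiability of \<open>g1\<close> at 0 enters, not continuity of a second derivative.\<close>

lemma little_o_square:
  fixes g :: "real \<Rightarrow> real"
  assumes "e > 0" and g1: "\<And>s. \<bar>s\<bar> < e \<Longrightarrow> (g has_real_derivative g1 s) (at s)"
    and "g1 0 = 0" and g2: "(g1 has_real_derivative 0) (at 0)" and "c > 0"
  obtains d where "d > 0" "d \<le> e" "\<And>s. \<bar>s\<bar> < d \<Longrightarrow> \<bar>g s - g 0\<bar> \<le> c * s\<^sup>2"
proof -
  have "((\<lambda>s. (g1 s - g1 0) / (s - 0)) \<longlongrightarrow> 0) (at 0)"
    using g2 by (simp add: has_field_derivative_iff)
  then have "eventually (\<lambda>s. dist (g1 s / s) 0 < c) (at 0)"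
    using \<open>c > 0\<close> \<open>g1 0 = 0\<close> by (auto dest: tendstoD)
  then obtain d where d: "d > 0" "\<And>s. s \<noteq> 0 \<Longrightarrow> \<bar>s\<bar> < d \<Longrightarrow> \<bar>g1 s / s\<bar> < c"
    unfolding eventually_at by (auto simp: dist_real_def)
  have g1c: "\<bar>g1 s\<bar> \<le> c * \<bar>s\<bar>" if "\<bar>s\<bar> < d" for s
    using d(2)[OF _ that] \<open>g1 0 = 0\<close> by (cases "s = 0") (auto simp: abs_divide pos_divide_less_eq less_imp_le)
  show thesis
  proof (rule that[of "min d e"])
    fix s :: real assume s: "\<bar>s\<bar> < min d e"
    show "\<bar>g s - g 0\<bar> \<le> c * s\<^sup>2"
    proof -
      have "norm (g s - g 0) \<le> (c * \<bar>s\<bar>) * norm (s - 0)"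
      proof (rule field_differentiable_bound[of "cball 0 \<bar>s\<bar>" g g1])
        fix z :: real assume "z \<in> cball 0 \<bar>s\<bar>"
        then have z: "\<bar>z\<bar> \<le> \<bar>s\<bar>" by (simp add: dist_real_def)
        show "(g has_field_derivative g1 z) (at z within cball 0 \<bar>s\<bar>)"
          using g1[of z] z s by (auto intro: has_field_derivative_at_within)
        show "norm (g1 z) \<le> c * \<bar>s\<bar>"
          using g1c[of z] z s \<open>c > 0\<close> by (auto intro: order_trans mult_left_mono)
      qed auto
      then show ?thesis by (simp add: power2_eq_square mult.assoc)
    qed
  qed (use d \<open>e > 0\<close> in auto)
qed

context anisotropy
begin

text \<open>If the second derivative vanished in a direction \<open>w\<close> tangent to the level set, \<open>F (x \<plusminus> s w)\<close>
  would be \<open>F x + o(s\<^sup>2)\<close>, whereas uniform convexity of the sublevel set forces a gain of order \<open>s\<^sup>2\<close>.\<close>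
lemma d2F_tangential_pos:
  assumes x: "x \<noteq> 0" and t: "pd F w x = 0" and z: "pd (pd F w) w x = 0"
  shows "w = 0"
proof (rule ccontr)
  assume w: "w \<noteq> 0"
  define l where "l = F x"
  have l: "l > 0" using F_pos[OF x] by (simp add: l_def)
  obtain c where c: "c > 0" and conv: "\<And>a b. F a \<le> l \<Longrightarrow> F b \<le> l \<Longrightarrow> cball (midpoint a b) (c * (norm (a - b))\<^sup>2) \<subseteq> {v. F v \<le> l}"
    using F_uniform[of l] unfolding uniformly_convex_set_def by auto
  \<comment> \<open>The gain of uniform convexity relative to |x|: the chord from x - s w to x + s w
    has length 2 s |w|.\<close>
  define k where "k = c * (2 * norm w)\<^sup>2 / norm x"
  have k: "k > 0" using c w x by (simp add: k_def)
  \<comment> \<open>The allowed o(s^2) error: an eighth of the gain, in units of the level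
    \<open>l\<close>.\<close>
  define c' where "c' = l * k / 8"
  have c': "c' > 0" using k l by (simp add: c'_def)
  obtain e where e: "e > 0" "\<And>s. \<bar>s\<bar> < e \<Longrightarrow> x + s *\<^sub>R w \<noteq> 0" using line_nonzero[OF x] by blast
  obtain d where d: "d > 0" "d \<le> e" "\<And>s. \<bar>s\<bar> < d \<Longrightarrow> \<bar>F (x + s *\<^sub>R w) - F (x + 0 *\<^sub>R w)\<bar> \<le> c' * s\<^sup>2"
  proof (rule little_o_square[OF e(1), of "\<lambda>s. F (x + s *\<^sub>R w)" "\<lambda>s. pd F w (x + s *\<^sub>R w)" c'])
    show "((\<lambda>s. F (x + s *\<^sub>R w)) has_real_derivative pd F w (x + s *\<^sub>R w)) (at s)" if "\<bar>s\<bar> < e" for s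
      by (intro pd_line F_diff e(2) that)
    show "((\<lambda>s. pd F w (x + s *\<^sub>R w)) has_real_derivative 0) (at 0)"
      using pd_line[of "pd F w" x 0 w UNIV] F_diff2[OF x] z by simp
  qed (use t c' in auto)
  \<comment> \<open>The bound by the square root gives k s^2 <= 8, and so L <= 2 below.\<close>
  define s where "s = min (d / 2) (min 1 (sqrt (8 / k)))"
  have s: "s > 0" "s < d" using d(1) k by (auto simp: s_def)
  have ks: "k * s\<^sup>2 \<le> 8"
  proof -
    have "s\<^sup>2 \<le> (sqrt (8 / k))\<^sup>2" using s by (intro power_mono) (auto simp: s_def)
    then show ?thesis using k by (simp add: field_simps)
  qed
  \<comment> \<open>Dividing by \<open>L\<close> moves both x + s w and x - s w into the sublevel
    set of \<open>l\<close>.\<close>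
  define L where "L = 1 + k * s\<^sup>2 / 8"
  have L: "1 < L" "L \<le> 2" using s k ks by (auto simp: L_def)
  have FL: "F ((1 / L) *\<^sub>R (x + r *\<^sub>R w)) \<le> l" if "r = s \<or> r = - s" for r
  proof -
    have "F (x + r *\<^sub>R w) \<le> l + c' * s\<^sup>2" using d(3)[of r] that s by (auto simp: l_def)
    also have "\<dots> = L * l" by (simp add: L_def c'_def algebra_simps)
    finally have "F (x + r *\<^sub>R w) \<le> L * l" .
    moreover have "F ((1 / L) *\<^sub>R (x + r *\<^sub>R w)) = (1 / L) * F (x + r *\<^sub>R w)"
      using L by (intro F_hom) simp
    ultimately show ?thesis using L by (simp add: pos_divide_le_eq mult.commute)
  qed
  define a where "a = (1 / L) *\<^sub>R (x + s *\<^sub>R w)"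
  define b where "b = (1 / L) *\<^sub>R (x + (- s) *\<^sub>R w)"
  have mid: "midpoint a b = (1 / L) *\<^sub>R x"
    by (simp add: a_def b_def midpoint_def algebra_simps flip: scaleR_2)
  have "a - b = (2 * s / L) *\<^sub>R w"
    by (simp add: a_def b_def algebra_simps flip: scaleR_2)
  then have nab: "c * (norm (a - b))\<^sup>2 = k * s\<^sup>2 / L\<^sup>2 * norm x"
    using s L x by (simp add: k_def power_mult_distrib power_divide)
  \<comment> \<open>The point of the uniform convexity ball farthest out on the ray of
    \<open>x\<close>.\<close>
  define y where "y = ((1 / L) * (1 + k * s\<^sup>2 / L)) *\<^sub>R x"
  have "dist (midpoint a b) y = k * s\<^sup>2 / L\<^sup>2 * norm x"
  proof -
    have "midpoint a b - y = (- (k * s\<^sup>2 / L\<^sup>2)) *\<^sub>R x"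
      using L by (simp add: mid y_def algebra_simps power2_eq_square)
    then show ?thesis using k by (simp add: dist_norm)
  qed
  then have "y \<in> cball (midpoint a b) (c * (norm (a - b))\<^sup>2)" by (simp add: nab)
  moreover have "F a \<le> l" "F b \<le> l" using FL unfolding a_def b_def by blast+
  ultimately have "F y \<le> l" using conv by blast
  moreover have "F y = ((1 / L) * (1 + k * s\<^sup>2 / L)) * l"
    unfolding y_def l_def using L k by (intro F_hom) (simp add: add_pos_nonneg)
  ultimately have "(1 / L) * (1 + k * s\<^sup>2 / L) \<le> 1"
    using l mult_le_cancel_right[of "(1 / L) * (1 + k * s\<^sup>2 / L)" l 1] by simp
  moreover have "X \<le> L" if "(1 / L) * X \<le> 1" for X
    using that L by (simp add: pos_divide_le_eq)
  ultimately have "1 + k * s\<^sup>2 / L \<le> L" by blast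
  also have "L = 1 + k * s\<^sup>2 / 8" by (rule L_def)
  finally have "k * s\<^sup>2 / L \<le> k * s\<^sup>2 / 8" by simp
  \<comment> \<open>The previous inequality says L >= 8, against L <= 2.\<close>
  moreover have "k * s\<^sup>2 / 8 < k * s\<^sup>2 / L" using L k s by (intro divide_strict_left_mono) auto
  ultimately show False by simp
qed

text \<open>Subtracting the radial part makes \<open>w\<close> tangent to the level set, and by
  Euler's relations it does not change the Hessian form; then \<open>d2F_tangential_pos\<close>
  applies.\<close>

lemma d2F_null:
  assumes x: "x \<noteq> 0" and z: "pd (pd F w) w x = 0"
  shows "w = (pd F w x / F x) *\<^sub>R x"
proof -
  define c where "c = pd F w x / F x"
  have lin: "linear (\<lambda>v. pd F v x)" "\<And>w. linear (\<lambda>v. pd (pd F v) w x)" "\<And>v. linear (\<lambda>w. pd (pd F v) w x)"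
    using linear_dF[OF x] linear_d2F[OF x] by auto
  have "w - c *\<^sub>R x = 0"
  proof (rule d2F_tangential_pos[OF x])
    show "pd F (w - c *\<^sub>R x) x = 0"
      using F_pos[OF x] by (simp add: linear_diff[OF lin(1)] linear_scale[OF lin(1)] Euler1[OF x] c_def)
    show "pd (pd F (w - c *\<^sub>R x)) (w - c *\<^sub>R x) x = 0"
      using z d2F_sym[OF x, of x w]
      by (simp add: linear_diff[OF lin(2)] linear_scale[OF lin(2)] linear_diff[OF lin(3)]
          linear_scale[OF lin(3)] Euler2[OF x])
  qed
  then show ?thesis by (simp add: c_def)
qed

end

section \<open>Coefficients near the equator\<close>

context anisotropy
begin

definition gm :: "(real^'n) \<times> real \<Rightarrow> 'n \<Rightarrow> 'n \<Rightarrow> real" where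
  "gm x i j = pd (pd F (phi i)) (phi j) x"

definition Bm :: "(real^'n) \<times> real \<Rightarrow> 'n \<Rightarrow> 'n \<Rightarrow> real" where
  "Bm x i j = pd (pd (pd F (phi i)) (phi j)) phi0 x"

definition Xv :: "(real^'n) \<times> real \<Rightarrow> 'n \<Rightarrow> real" where
  "Xv x i = pd F (phi i) x"

text \<open>The mixed row of D^2 F. It enters because g e = r Y at (e, -r).\<close>

definition Yv :: "(real^'n) \<times> real \<Rightarrow> 'n \<Rightarrow> real" where
  "Yv x i = pd (pd F phi0) (phi i) x"

definition F0 :: "(real^'n) \<times> real \<Rightarrow> real" where "F0 x = pd F phi0 x"
definition F00 :: "(real^'n) \<times> real \<Rightarrow> real" where "F00 x = pd (pd F phi0) phi0 x"
definition F000 :: "(real^'n) \<times> real \<Rightarrow> real" where "F000 x = pd (pd (pd F phi0) phi0) phi0 x"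

lemma dF_horizontal: "x \<noteq> 0 \<Longrightarrow> pd F (a, 0) x = (\<Sum>i\<in>UNIV. a $ i * Xv x i)"
  unfolding Xv_def by (rule linear_horizontal_expansion[OF linear_dF])

lemma quad_gm:
  assumes x: "x \<noteq> 0"
  shows "quad (gm x) (($) a) (($) b) = pd (pd F (a, 0)) (b, 0) x"
  unfolding linear_horizontal_expansion[OF linear_d2F(1)[OF x], of a]
    linear_horizontal_expansion[OF linear_d2F(2)[OF x], of _ b]
  unfolding quad_def gm_def by (subst sum.swap) (simp add: sum_distrib_left ac_simps)

lemma gm_apply: "x \<noteq> 0 \<Longrightarrow> (\<Sum>j\<in>UNIV. gm x i j * b $ j) = pd (pd F (phi i)) (b, 0) x"
  by (simp add: linear_horizontal_expansion[OF linear_d2F(2)] gm_def ac_simps)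

lemma quad_Bm:
  assumes x: "x \<noteq> 0"
  shows "quad (Bm x) (($) a) (($) b) = pd (pd (pd F (a, 0)) (b, 0)) phi0 x"
  unfolding linear_horizontal_expansion[OF linear_d3F(1)[OF x], of a]
    linear_horizontal_expansion[OF linear_d3F(2)[OF x], of _ b]
  unfolding quad_def Bm_def by (subst sum.swap) (simp add: sum_distrib_left ac_simps)

lemma gm_sym: "x \<noteq> 0 \<Longrightarrow> gm x i j = gm x j i"
  unfolding gm_def by (rule d2F_sym)

lemma gm_psd: "x \<noteq> 0 \<Longrightarrow> 0 \<le> quad (gm x) v v"
  using quad_gm[of x "\<chi> i. v i" "\<chi> i. v i"] d2F_nonneg[of x] by (simp add: vec_lambda_inverse)

lemma F00_nonneg: "x \<noteq> 0 \<Longrightarrow> 0 \<le> F00 x"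
  unfolding F00_def by (rule d2F_nonneg)

text \<open>D^2 F is null only on the radial line, and \<open>phi0\<close> is not a multiple of a
  covector with nonzero horizontal part.\<close>

lemma F00_pos:
  assumes "e \<noteq> 0"
  shows "0 < F00 (e, r)"
proof (rule ccontr)
  have x: "(e, r) \<noteq> 0" using assms by (simp add: prod_eq_iff)
  assume "\<not> ?thesis"
  then have "F00 (e, r) = 0" using F00_nonneg[OF x] by simp
  then obtain c where c: "phi0 = c *\<^sub>R (e, r)" using d2F_null[OF x] unfolding F00_def by blast
  then have "c *\<^sub>R e = 0" by (simp add: phi0_def prod_eq_iff)
  then have "c = 0" using assms by simp
  then show False using c by (simp add: phi0_def prod_eq_iff)
qed

text \<open>Write (e, 0) = x + r phi0 with x = (e, -r). Euler's relations kill x in D^2 F and turn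
  it into a lower derivative in D^3 F, so each expression has a factor r. These factors absorb the
  coefficient b / r of the rank-one part of the Hessian.\<close>

lemma quad_gm_self:
  assumes "(e, - r) \<noteq> 0"
  shows "quad (gm (e, - r)) (($) e) (($) e) = r\<^sup>2 * F00 (e, - r)"
    and "(\<Sum>j\<in>UNIV. gm (e, - r) i j * e $ j) = r * Yv (e, - r) i"
    and "quad (Bm (e, - r)) (($) e) (($) e) = r * (r * F000 (e, - r) - 2 * F00 (e, - r))"
proof -
  define x where "x = (e, - r)"
  have x: "x \<noteq> 0" using assms by (simp add: x_def)
  have e: "(e, 0) = x + r *\<^sub>R phi0" by (simp add: x_def phi0_def)
  have lin2: "pd (pd F (v + c *\<^sub>R v')) w x = pd (pd F v) w x + c * pd (pd F v') w x"
    "pd (pd F w) (v + c *\<^sub>R v') x = pd (pd F w) v x + c * pd (pd F w) v' x" for v v' w c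
    by (simp_all add: linear_add[OF linear_d2F(1)[OF x, of w]] linear_scale[OF linear_d2F(1)[OF x, of w]]
        linear_add[OF linear_d2F(2)[OF x, of w]] linear_scale[OF linear_d2F(2)[OF x, of w]])
  have lin3: "pd (pd (pd F (v + c *\<^sub>R v')) w) z x = pd (pd (pd F v) w) z x + c * pd (pd (pd F v') w) z x"
    "pd (pd (pd F w) (v + c *\<^sub>R v')) z x = pd (pd (pd F w) v) z x + c * pd (pd (pd F w) v') z x" for v v' w z c
    by (simp_all add: linear_add[OF linear_d3F(1)[OF x, of w z]] linear_scale[OF linear_d3F(1)[OF x, of w z]]
        linear_add[OF linear_d3F(2)[OF x, of w z]] linear_scale[OF linear_d3F(2)[OF x, of w z]])
  have E2: "pd (pd F v) x x = 0" "pd (pd F x) v x = 0" for v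
    using Euler2[OF x] d2F_sym[OF x, of x v] by auto
  have E3: "pd (pd (pd F v) x) w x = - pd (pd F v) w x" "pd (pd (pd F x) v) w x = - pd (pd F v) w x" for v w
    using Euler3[OF x] d3F_sym(1)[OF x, of x v w] d3F_sym(2)[OF x, of v x w] by auto
  show "quad (gm (e, - r)) (($) e) (($) e) = r\<^sup>2 * F00 (e, - r)"
    unfolding x_def[symmetric] quad_gm[OF x] e lin2 E2 F00_def by (simp add: power2_eq_square)
  show "(\<Sum>j\<in>UNIV. gm (e, - r) i j * e $ j) = r * Yv (e, - r) i"
    unfolding x_def[symmetric] gm_apply[OF x] e
    by (simp add: lin2 E2 Yv_def d2F_sym[OF x, of phi0])
  show "quad (Bm (e, - r)) (($) e) (($) e) = r * (r * F000 (e, - r) - 2 * F00 (e, - r))"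
    unfolding x_def[symmetric] quad_Bm[OF x] e
    by (simp add: lin2 lin3 E2 E3 F00_def F000_def algebra_simps)
qed

text \<open>The number X.e, which is DF(e, 0) and by Euler F + r F0 at (e, -r). It normalises the
  rank-one part of the Hessian so that the remainder satisfies k X = 0.\<close>

definition Gh :: "real^'n \<Rightarrow> real \<Rightarrow> real" where
  "Gh e r = (\<Sum>i\<in>UNIV. e $ i * Xv (e, - r) i)"

text \<open>The quadratic form of the maximum principle at the covector \<open>(e, - r)\<close> and the Hessian
  \<open>(b / r) e e\<^sup>T + k\<close>, with the singular factor \<open>1 / r\<close> cancelled, plus the claimed gain.\<close>
definition Phi :: "real^'n \<Rightarrow> real \<Rightarrow> real \<Rightarrow> real^'n^'n \<Rightarrow> real" where
  "Phi e r b k = b * Gh e r * (F0 (e, - r) * (b * r * F00 (e, - r) + pairing (gm (e, - r)) (\<lambda>i j. k $ i $ j)))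
    + b * Gh e r * F (e, - r) * (b * (r * F000 (e, - r) - 2 * F00 (e, - r)) + pairing (Bm (e, - r)) (\<lambda>i j. k $ i $ j))
    - F (e, - r) * (b\<^sup>2 * r\<^sup>2 * (F00 (e, - r))\<^sup>2 + 2 * b * r * quad (\<lambda>i j. k $ i $ j) (Yv (e, - r)) (Yv (e, - r))
      + trace_sq (gm (e, - r)) (\<lambda>i j. k $ i $ j))
    + 3 / 2 * b\<^sup>2 * (Gh e r)\<^sup>2 * F00 (e, - r)"

text \<open>Links \<open>Phi\<close> to the expression of the maximum principle. The singular
  coefficient \<open>s\<close> enters only through \<open>s * r = b\<close>, so nothing is divided
  by r.\<close>

lemma Phi_eq:
  assumes e: "e \<noteq> 0" and s: "s * r = b" and k: "\<And>i j. k $ i $ j = k $ j $ i"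
    and h: "\<And>i j. h i j = s * (e $ i * e $ j) + k $ i $ j"
  shows "Phi e r b k = b * Gh e r * (F0 (e, - r) * pairing (gm (e, - r)) h + F (e, - r) * pairing (Bm (e, - r)) h)
    - F (e, - r) * trace_sq (gm (e, - r)) h + 3 / 2 * b\<^sup>2 * (Gh e r)\<^sup>2 * F00 (e, - r)"
proof -
  define x where "x = (e, - r)"
  have x: "x \<noteq> 0" using e by (simp add: x_def prod_eq_iff)
  have h': "h = (\<lambda>i j. s * (e $ i * e $ j) + k $ i $ j)" using h by blast
  have 1: "pairing (gm x) h = b * r * F00 x + pairing (gm x) (\<lambda>i j. k $ i $ j)"
    using quad_gm_self(1)[OF x[unfolded x_def]]
    by (simp add: h' pairing_rank_one_add x_def flip: s) (simp add: power2_eq_square)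
  have 2: "pairing (Bm x) h = b * (r * F000 x - 2 * F00 x) + pairing (Bm x) (\<lambda>i j. k $ i $ j)"
    using quad_gm_self(3)[OF x[unfolded x_def]]
    by (simp add: h' pairing_rank_one_add x_def flip: s)
  have 3: "trace_sq (gm x) h = b\<^sup>2 * r\<^sup>2 * (F00 x)\<^sup>2 + 2 * b * r * quad (\<lambda>i j. k $ i $ j) (Yv x) (Yv x)
      + trace_sq (gm x) (\<lambda>i j. k $ i $ j)"
  proof -
    have "trace_sq (gm x) h = s\<^sup>2 * (quad (gm x) (($) e) (($) e))\<^sup>2
      + 2 * s * quad (\<lambda>i j. k $ i $ j) (\<lambda>i. r * Yv x i) (\<lambda>i. r * Yv x i) + trace_sq (gm x) (\<lambda>i j. k $ i $ j)"
      unfolding h' by (rule trace_sq_rank_one_add) (use gm_sym[OF x] k quad_gm_self(2)[OF x[unfolded x_def]] in \<open>simp_all add: x_def\<close>)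
    then show ?thesis using quad_gm_self(1)[OF x[unfolded x_def]]
      by (simp add: quad_scale_left quad_scale_right x_def flip: s) (simp add: power2_eq_square ac_simps)
  qed
  show ?thesis unfolding Phi_def x_def[symmetric] 1 2 3 by (simp add: algebra_simps)
qed

text \<open>A null vector of g on the equator is a multiple of e, with factor X.v / F; orthogonality
  to X makes this factor zero.\<close>

lemma quad_gm_null:
  assumes "e \<noteq> 0" and "quad (gm (e, 0)) v v = 0" and "(\<Sum>i\<in>UNIV. v i * Xv (e, 0) i) = 0"
  shows "v i = 0"
proof -
  define w where "w = (\<chi> i. v i)"
  have x: "(e, 0 :: real) \<noteq> 0" using assms(1) by (simp add: prod_eq_iff)
  have "pd (pd F (w, 0)) (w, 0) (e, 0) = 0"
    using quad_gm[OF x, of w w] assms(2) by (simp add: w_def vec_lambda_inverse)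
  moreover have "pd F (w, 0) (e, 0) = 0" using dF_horizontal[OF x, of w] assms(3) by (simp add: w_def)
  ultimately have "(w, 0 :: real) = 0" using d2F_null[OF x, of "(w, 0)"] by (simp add: zero_prod_def)
  then show ?thesis by (simp add: w_def prod_eq_iff vec_eq_iff)
qed

text \<open>The null direction of g is excluded twice by k X = 0: first for the vectors k g w,
  giving k g = 0, then for the rows of k themselves.\<close>

lemma trace_sq_gm_zero:
  assumes e: "e \<noteq> 0" and k: "\<And>i j. k i j = k j i" and X: "\<And>j. (\<Sum>i\<in>UNIV. Xv (e, 0) i * k i j) = 0"
    and T: "trace_sq (gm (e, 0)) k = 0"
  shows "k i j = 0"
proof -
  have x: "(e, 0 :: real) \<noteq> 0" using e by (simp add: prod_eq_iff)
  define c where "c w j = (\<Sum>l\<in>UNIV. gm (e, 0) j l * w l)" for w j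
  define y where "y w i = (\<Sum>j\<in>UNIV. k i j * c w j)" for w i
  have kX: "(\<Sum>j\<in>UNIV. k i j * Xv (e, 0) j) = 0" for i
    using X[of i] by (simp add: k[of i] mult.commute)
  have y0: "y w i = 0" for w i
  proof (rule quad_gm_null[OF e])
    show "quad (gm (e, 0)) (y w) (y w) = 0"
      unfolding y_def c_def by (rule trace_sq_zero_imp_null) (use gm_sym[OF x] gm_psd[OF x] k T in blast)+
    have "(\<Sum>i\<in>UNIV. y w i * Xv (e, 0) i) =
      (\<Sum>i\<in>UNIV. \<Sum>j\<in>UNIV. c w j * (Xv (e, 0) i * k i j))"
      unfolding y_def by (simp add: sum_distrib_left sum_distrib_right ac_simps)
    also have "\<dots> = (\<Sum>j\<in>UNIV. \<Sum>i\<in>UNIV. c w j * (Xv (e, 0) i * k i j))"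
      by (rule sum.swap)
    also have "\<dots> = 0" by (simp only: sum_distrib_left[symmetric] X mult_zero_right sum.neutral_const)
    finally show "(\<Sum>i\<in>UNIV. y w i * Xv (e, 0) i) = 0" .
  qed
  show ?thesis
  proof (rule quad_gm_null[OF e, of "k i"])
    have "quad (gm (e, 0)) (k i) (k i) = y (k i) i"
      unfolding quad_def y_def c_def by (simp add: sum_distrib_left ac_simps)
    then show "quad (gm (e, 0)) (k i) (k i) = 0" by (simp add: y0)
  qed (rule kX)
qed

lemma Gh_zero: "e \<noteq> 0 \<Longrightarrow> Gh e 0 = F (e, 0)"
  using dF_horizontal[of "(e, 0)" e] Euler1[of "(e, 0)"] by (simp add: Gh_def prod_eq_iff)

lemma Phi_horizontal_neg:
  assumes e: "e \<noteq> 0" and k: "\<And>i j. k $ i $ j = k $ j $ i"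
    and X: "\<And>j. (\<Sum>i\<in>UNIV. Xv (e, 0) i * k $ i $ j) = 0" and nz: "(b, k) \<noteq> 0"
  shows "Phi e 0 b k < 0"
proof -
  have x: "(e, 0 :: real) \<noteq> 0" using e by (simp add: prod_eq_iff)
  define T where "T = trace_sq (gm (e, 0)) (\<lambda>i j. k $ i $ j)"
  have T: "T \<ge> 0" unfolding T_def by (rule trace_sq_nonneg[OF gm_sym[OF x] gm_psd[OF x] k])
  have F: "F (e, 0) > 0" by (rule F_pos[OF x])
  have F00: "F00 (e, 0) > 0" by (rule F00_pos[OF e])
  have "F0 (e, 0) = 0" unfolding F0_def by (rule dF_vertical[OF e])
  moreover have "Bm (e, 0) i j = 0" for i j unfolding Bm_def by (rule d3F_vertical[OF e])
  \<comment> \<open>The coefficient -1/2 is the -2 from B(e, e) plus the claimed gain 3/2.\<close>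
  ultimately have eq: "Phi e 0 b k = - (1 / 2 * b\<^sup>2 * (F (e, 0))\<^sup>2 * F00 (e, 0)) - F (e, 0) * T"
    by (simp add: Phi_def Gh_zero[OF e] pairing_def T_def) (simp add: algebra_simps power2_eq_square)
  show ?thesis
  proof (cases "b = 0")
    case True
    have "T \<noteq> 0"
    proof
      assume "T = 0"
      then have "k $ i $ j = 0" for i j
        using trace_sq_gm_zero[of e "\<lambda>i j. k $ i $ j" i j] e k X by (simp add: T_def)
      then have "k = 0" by (simp add: vec_eq_iff)
      then show False using nz True by (simp add: prod_eq_iff)
    qed
    then show ?thesis using T F True unfolding eq by simp
  next
    case False
    have "1 / 2 * b\<^sup>2 * (F (e, 0))\<^sup>2 * F00 (e, 0) > 0" using False F F00 by simp
    moreover have "F (e, 0) * T \<ge> 0" using F T by simp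
    ultimately show ?thesis unfolding eq by linarith
  qed
qed

text \<open>Lets the compactness argument run on the unit sphere of pairs (b, k).\<close>

lemma Phi_scale: "Phi e r (c * b) (c *\<^sub>R k) = c\<^sup>2 * Phi e r b k"
proof -
  define h where "h = (\<lambda>i j. k $ i $ j)"
  have ch: "(\<lambda>i j. (c *\<^sub>R k) $ i $ j) = (\<lambda>i j. c * h i j)" by (simp add: h_def)
  have scale: "pairing g (\<lambda>i j. c * h i j) = c * pairing g h" "quad (\<lambda>i j. c * h i j) y y = c * quad h y y" for g y
    by (simp_all add: pairing_def quad_def sum_distrib_left ac_simps)
  have tr: "trace_sq g (\<lambda>i j. c * h i j) = c\<^sup>2 * trace_sq g h" for g
  proof -
    have "(\<Sum>l\<in>UNIV. g i l * (c * h l j)) = c * (\<Sum>l\<in>UNIV. g i l * h l j)" for i j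
      by (simp add: sum_distrib_left ac_simps)
    then show ?thesis
      unfolding trace_sq_def sum_distrib_left[of "c\<^sup>2"] by (simp add: power2_eq_square ac_simps)
  qed
  show ?thesis
    unfolding Phi_def ch h_def[symmetric] scale tr by (simp add: algebra_simps power2_eq_square)
qed

section \<open>Uniform estimates near the equator by compactness\<close>

lemma continuous_on_slanted:
  fixes e :: "'a::topological_space \<Rightarrow> real^'n"
  assumes "continuous_on \<Omega> h" "continuous_on K e" "continuous_on K r" "\<And>z. z \<in> K \<Longrightarrow> e z \<noteq> 0"
  shows "continuous_on K (\<lambda>z. h (e z, - r z))"
  by (rule continuous_on_compose2[OF assms(1)])
    (use assms in \<open>auto intro!: continuous_intros simp: prod_eq_iff\<close>)

lemma continuous_on_coefficients:
  fixes e :: "'a::topological_space \<Rightarrow> real^'n"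
  assumes "continuous_on K e" "continuous_on K r" "\<And>z. z \<in> K \<Longrightarrow> e z \<noteq> 0"
  shows "continuous_on K (\<lambda>z. F (e z, - r z))" "continuous_on K (\<lambda>z. F0 (e z, - r z))"
    "continuous_on K (\<lambda>z. F00 (e z, - r z))" "continuous_on K (\<lambda>z. F000 (e z, - r z))"
    "continuous_on K (\<lambda>z. Xv (e z, - r z) i)" "continuous_on K (\<lambda>z. Yv (e z, - r z) i)"
    "continuous_on K (\<lambda>z. gm (e z, - r z) i j)" "continuous_on K (\<lambda>z. Bm (e z, - r z) i j)"
    "continuous_on K (\<lambda>z. Gh (e z) (r z))"
proof -
  show "continuous_on K (\<lambda>z. F (e z, - r z))" "continuous_on K (\<lambda>z. F0 (e z, - r z))"
    "continuous_on K (\<lambda>z. F00 (e z, - r z))" "continuous_on K (\<lambda>z. F000 (e z, - r z))"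
    "continuous_on K (\<lambda>z. Yv (e z, - r z) i)"
    "continuous_on K (\<lambda>z. gm (e z, - r z) i j)" "continuous_on K (\<lambda>z. Bm (e z, - r z) i j)"
    unfolding F0_def F00_def F000_def Xv_def Yv_def gm_def Bm_def
    by (intro continuous_on_slanted[OF _ assms] cont_F cont_dF cont_d2F cont_d3F; assumption)+
  show X: "continuous_on K (\<lambda>z. Xv (e z, - r z) i)" for i
    unfolding Xv_def by (intro continuous_on_slanted[OF _ assms] cont_dF; assumption)
  show "continuous_on K (\<lambda>z. Gh (e z) (r z))"
    unfolding Gh_def by (intro continuous_intros assms X)
qed

end

text \<open>Used in two ways: on the values of a positive function, and on the coordinate r over a
  compact set of bad points that misses r = 0. The second use produces a threshold for r below which
  nothing bad happens.\<close>

lemma compact_pos_bound: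
  fixes f :: "'a::topological_space \<Rightarrow> real"
  assumes "compact C" "continuous_on C f" "\<And>x. x \<in> C \<Longrightarrow> f x > 0"
  shows "\<exists>m>0. \<forall>x\<in>C. m \<le> f x"
proof (cases "C = {}")
  case True
  then show ?thesis by (intro exI[of _ 1]) simp
next
  case False
  then obtain x where "x \<in> C" "\<forall>y\<in>C. f x \<le> f y"
    using continuous_attains_inf[OF assms(1) _ assms(2)] by blast
  then show ?thesis using assms(3) by blast
qed

context anisotropy
begin

text \<open>The product has degree zero, so unit \<open>e\<close> with r <= 1 covers all (p, -1)
  with |p| >= 1. The constant found here determines A.\<close>

lemma FF00_bound: "\<exists>c>0. \<forall>e r. norm e = 1 \<longrightarrow> 0 \<le> r \<longrightarrow> r \<le> 1 \<longrightarrow> c \<le> F (e, - r) * F00 (e, - r)"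
proof -
  let ?K = "sphere (0 :: real^'n) 1 \<times> {0..1 :: real}"
  have "\<exists>c>0. \<forall>z\<in>?K. c \<le> F (fst z, - snd z) * F00 (fst z, - snd z)"
  proof (rule compact_pos_bound)
    show "compact ?K" by (intro compact_Times) auto
    show "continuous_on ?K (\<lambda>z. F (fst z, - snd z) * F00 (fst z, - snd z))"
      by (intro continuous_on_mult continuous_on_coefficients continuous_intros) auto
    show "0 < F (fst z, - snd z) * F00 (fst z, - snd z)" if "z \<in> ?K" for z
    proof -
      have "fst z \<noteq> 0" using that by auto
      then show ?thesis using F00_pos F_pos by (simp add: prod_eq_iff)
    qed
  qed
  then show ?thesis by force
qed

text \<open>At r = 0 the function is F > 0, so the compact set where it is nonpositive stays away
  from r = 0. Positivity permits a to be written as b times \<open>Gh\<close>.\<close>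

lemma Gh_pos: "\<exists>r0>0. \<forall>e r. norm e = 1 \<longrightarrow> 0 \<le> r \<longrightarrow> r < r0 \<longrightarrow> 0 < Gh e r"
proof -
  let ?K = "sphere (0 :: real^'n) 1 \<times> {0..1 :: real}"
  let ?G = "\<lambda>z. Gh (fst z) (snd z)"
  have K: "compact ?K" by (intro compact_Times) auto
  have G: "continuous_on ?K ?G"
    by (intro continuous_on_coefficients continuous_intros) auto
  have C: "compact (?K \<inter> ?G -` {..0})"
    using continuous_closed_preimage[OF G compact_imp_closed[OF K] closed_atMost] K
    by (metis compact_Int_closed Int_left_absorb)
  have "\<exists>m>0. \<forall>z\<in>?K \<inter> ?G -` {..0}. m \<le> snd z"
  proof (rule compact_pos_bound[OF C])
    show "continuous_on (?K \<inter> ?G -` {..0}) snd" by (intro continuous_intros)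
    show "0 < snd z" if z: "z \<in> ?K \<inter> ?G -` {..0}" for z
    proof (rule ccontr)
      assume "\<not> 0 < snd z"
      then have s: "snd z = 0" using z by auto
      have "fst z \<noteq> 0" using z by auto
      then have "Gh (fst z) (snd z) > 0" using s Gh_zero F_pos by (simp add: prod_eq_iff)
      then show False using z by simp
    qed
  qed
  then obtain m where m: "m > 0" "\<And>z. z \<in> ?K \<inter> ?G -` {..0} \<Longrightarrow> m \<le> snd z" by blast
  have "0 < Gh e r" if "norm e = 1" "0 \<le> r" "r < min m 1" for e r
    using m(2)[of "(e, r)"] that by (force simp: not_less[symmetric])
  then show ?thesis using m(1) by (intro exI[of _ "min m 1"]) auto
qed

text \<open>The admissible k vary with (e, r), so symmetry and k X = 0 are encoded as the zero set
  of one continuous sum of squares. The unit (b, k) that are admissible with nonnegative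
  \<open>Phi\<close> form, together with (e, r), a compact set; \<open>Phi_horizontal_neg\<close>
  keeps it off r = 0.\<close>

lemma Phi_nonpos: "\<exists>r0>0. \<forall>e r b k. norm e = 1 \<longrightarrow> 0 \<le> r \<longrightarrow> r < r0 \<longrightarrow> (\<forall>i j. k $ i $ j = k $ j $ i) \<longrightarrow>
    (\<forall>j. (\<Sum>i\<in>UNIV. Xv (e, - r) i * k $ i $ j) = 0) \<longrightarrow> Phi e r b k \<le> 0"
proof -
  let ?K = "sphere (0 :: real^'n) 1 \<times> {0..1 :: real} \<times> sphere (0 :: real \<times> (real^'n^'n)) 1"
  let ?q = "\<lambda>z :: (real^'n) \<times> real \<times> real \<times> (real^'n^'n).
    (\<Sum>i\<in>UNIV. \<Sum>j\<in>UNIV. (snd (snd (snd z)) $ i $ j - snd (snd (snd z)) $ j $ i)\<^sup>2)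
    + (\<Sum>j\<in>UNIV. (\<Sum>i\<in>UNIV. Xv (fst z, - fst (snd z)) i * snd (snd (snd z)) $ i $ j)\<^sup>2)"
  let ?P = "\<lambda>z :: (real^'n) \<times> real \<times> real \<times> (real^'n^'n). Phi (fst z) (fst (snd z)) (fst (snd (snd z))) (snd (snd (snd z)))"
  let ?f = "\<lambda>z. (?q z, ?P z)"
  have q0: "?q z = 0 \<longleftrightarrow> (\<forall>i j. snd (snd (snd z)) $ i $ j = snd (snd (snd z)) $ j $ i) \<and>
     (\<forall>j. (\<Sum>i\<in>UNIV. Xv (fst z, - fst (snd z)) i * snd (snd (snd z)) $ i $ j) = 0)" for z
    by (simp add: add_nonneg_eq_0_iff sum_nonneg sum_nonneg_eq_0_iff)
  have K: "compact ?K" by (intro compact_Times) auto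
  have nz: "fst z \<noteq> 0" if "z \<in> ?K" for z using that by auto
  have ce: "continuous_on ?K fst" "continuous_on ?K (\<lambda>z. fst (snd z))" by (intro continuous_intros)+
  note coeffs = continuous_on_coefficients[OF ce nz]
  have f: "continuous_on ?K ?f"
    unfolding Phi_def quad_def pairing_def trace_sq_def
    by (intro continuous_intros coeffs) auto
  have C: "compact (?K \<inter> ?f -` ({0} \<times> {0..}))"
    using compact_Int_closed[OF K continuous_closed_preimage[OF f compact_imp_closed[OF K]
        closed_Times[OF closed_singleton closed_atLeast]], of 0 0]
    by (simp only: Int_left_absorb)
  have "\<exists>m>0. \<forall>z\<in>?K \<inter> ?f -` ({0} \<times> {0..}). m \<le> fst (snd z)"
  proof (rule compact_pos_bound[OF C])
    show "continuous_on (?K \<inter> ?f -` ({0} \<times> {0..})) (\<lambda>z. fst (snd z))" by (intro continuous_intros)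
    show "0 < fst (snd z)" if z: "z \<in> ?K \<inter> ?f -` ({0} \<times> {0..})" for z
    proof (rule ccontr)
      assume "\<not> 0 < fst (snd z)"
      then have s: "fst (snd z) = 0" using z by auto
      have "?q z = 0" using z by simp
      then have "(\<forall>i j. snd (snd (snd z)) $ i $ j = snd (snd (snd z)) $ j $ i)"
        "(\<forall>j. (\<Sum>i\<in>UNIV. Xv (fst z, 0) i * snd (snd (snd z)) $ i $ j) = 0)"
        using q0[of z] s by auto
      moreover have "fst z \<noteq> 0" "(fst (snd (snd z)), snd (snd (snd z))) \<noteq> 0" using z by auto
      ultimately have "?P z < 0" unfolding s by (intro Phi_horizontal_neg) auto
      then show False using z by simp
    qed
  qed
  then obtain m where m: "m > 0" "\<And>z. z \<in> ?K \<inter> ?f -` ({0} \<times> {0..}) \<Longrightarrow> m \<le> fst (snd z)" by blast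
  have "Phi e r b k \<le> 0" if e: "norm e = 1" and r: "0 \<le> r" "r < min m 1" and k: "\<forall>i j. k $ i $ j = k $ j $ i"
    and X: "\<forall>j. (\<Sum>i\<in>UNIV. Xv (e, - r) i * k $ i $ j) = 0" for e r b k
  proof (cases "(b, k) = 0")
    case True
    then show ?thesis using Phi_scale[of e r 0 0 0] by (simp add: prod_eq_iff)
  next
    case False
    define c where "c = 1 / norm (b, k)"
    have c: "c > 0" using False by (simp add: c_def)
    show ?thesis
    proof (rule ccontr)
      assume "\<not> Phi e r b k \<le> 0"
      then have P: "Phi e r (c * b) (c *\<^sub>R k) \<ge> 0" by (simp add: Phi_scale)
      define z where "z = (e, r, c * b, c *\<^sub>R k)"
      have "norm (c *\<^sub>R (b, k)) = 1" using False c by (simp add: norm_scaleR c_def del: scaleR_Pair)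
      then have "z \<in> ?K" using e r by (simp add: z_def)
      moreover have "?q z = 0" unfolding q0
        using k X by (simp add: z_def mult.left_commute sum_distrib_left[symmetric])
      moreover have "?P z \<ge> 0" using P by (simp add: z_def)
      ultimately have "m \<le> fst (snd z)" by (intro m(2)) simp
      then show False using r by (simp add: z_def)
    qed
  qed
  then show ?thesis using m(1) by (intro exI[of _ "min m 1"]) auto
qed

text \<open>Carries the estimate from unit e and small r to p = e / r: F is bounded on each ball of
  p, so a large value of F forces |p| to be large. The condition on \<open>H\<close> is the
  first-order condition h X = a Du at a maximum.\<close>

lemma gradient_estimate_algebra:
  "\<exists>c>0. \<exists>S>F (- phi0). \<forall>p. S \<le> F (p, - 1) \<longrightarrow> c \<le> F (p, - 1) * F00 (p, - 1) \<and>
    (\<forall>H a. (\<forall>i j. H i j = H j i) \<longrightarrow> (\<forall>j. (\<Sum>i\<in>UNIV. Xv (p, - 1) i * H i j) = a * p $ j) \<longrightarrow>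
      a * (F0 (p, - 1) * pairing (gm (p, - 1)) H + F (p, - 1) * pairing (Bm (p, - 1)) H)
        - F (p, - 1) * trace_sq (gm (p, - 1)) H \<le> - (3 / 2) * a\<^sup>2 * F00 (p, - 1))"
proof -
  obtain c where c: "c > 0" "\<And>e r. norm e = 1 \<Longrightarrow> 0 \<le> r \<Longrightarrow> r \<le> 1 \<Longrightarrow> c \<le> F (e, - r) * F00 (e, - r)"
    using FF00_bound by blast
  obtain r1 where r1: "r1 > 0" "\<And>e r. norm e = 1 \<Longrightarrow> 0 \<le> r \<Longrightarrow> r < r1 \<Longrightarrow> 0 < Gh e r"
    using Gh_pos by blast
  from Phi_nonpos obtain r2 where r2: "r2 > 0" "\<forall>e r b k. norm e = 1 \<longrightarrow> 0 \<le> r \<longrightarrow> r < r2 \<longrightarrow>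
    (\<forall>i j. k $ i $ j = k $ j $ i) \<longrightarrow> (\<forall>j. (\<Sum>i\<in>UNIV. Xv (e, - r) i * k $ i $ j) = 0) \<longrightarrow> Phi e r b k \<le> 0"
    by (elim exE conjE)
  \<comment> \<open>The halves make 1 / R strictly smaller than both thresholds.\<close>
  define R where "R = 1 / min 1 (min (r1 / 2) (r2 / 2))"
  have R: "R > 0" "1 / R \<le> 1" "1 / R < r1" "1 / R < r2" using r1(1) r2(1) by (auto simp: R_def)
  have "compact ((\<lambda>p. (p, - 1)) ` cball (0 :: real^'n) R)"
    by (intro compact_continuous_image continuous_intros) auto
  then have "compact (F ` (\<lambda>p. (p, - 1)) ` cball (0 :: real^'n) R)"
    by (rule compact_continuous_image[OF continuous_on_subset[OF cont_F], rotated]) (auto simp: prod_eq_iff)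
  \<comment> \<open>The bound is strict and the ball contains p = 0, which gives
    \<open>F (- phi0) < S0\<close>.\<close>
  then obtain S0 where S0: "\<And>p. norm p \<le> R \<Longrightarrow> F (p, - 1) < S0"
    using bounded_imp_bdd_above[OF compact_imp_bounded]
    by (fastforce simp: bdd_above_def intro: le_less_trans[OF _ less_add_one])
  have S0': "F (- phi0) < S0" using S0[of 0] R by (simp add: phi0_def)
  have "c \<le> F (p, - 1) * F00 (p, - 1) \<and> (\<forall>H a. (\<forall>i j. H i j = H j i) \<longrightarrow> (\<forall>j. (\<Sum>i\<in>UNIV. Xv (p, - 1) i * H i j) = a * p $ j) \<longrightarrow>
      a * (F0 (p, - 1) * pairing (gm (p, - 1)) H + F (p, - 1) * pairing (Bm (p, - 1)) H)
        - F (p, - 1) * trace_sq (gm (p, - 1)) H \<le> - (3 / 2) * a\<^sup>2 * F00 (p, - 1))" if p: "S0 \<le> F (p, - 1)" for p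
  proof -
    define r where "r = norm p"
    have r: "R < r" using S0[of p] p by (force simp: r_def)
    have r0: "r > 0" using r R by simp
    define e where "e = (1 / r) *\<^sub>R p"
    have e: "norm e = 1" "e \<noteq> 0" using r0 by (auto simp: e_def r_def)
    define d where "d = 1 / r"
    have "d < 1 / R" using r R by (simp add: d_def frac_less2)
    then have d: "0 < d" "d \<le> 1" "d < r1" "d < r2" using r0 r R by (auto simp: d_def)
    have dr: "d * r = 1" using r0 by (simp add: d_def)
    define x where "x = (e, - d)"
    have x: "x \<noteq> 0" using e by (simp add: x_def prod_eq_iff)
    have px: "(p, - 1) = r *\<^sub>R x" using r0 by (simp add: x_def e_def d_def)
    have pe: "p $ i = r * e $ i" for i using r0 by (simp add: e_def)
    have hom: "F (p, - 1) = r * F x" "F0 (p, - 1) = F0 x" "F00 (p, - 1) = 1 / r * F00 x" "Xv (p, - 1) i = Xv x i"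
      "gm (p, - 1) i j = 1 / r * gm x i j" "Bm (p, - 1) i j = 1 / r\<^sup>2 * Bm x i j" for i j
      unfolding px F0_def F00_def Xv_def gm_def Bm_def
      by (simp_all only: F_hom[OF r0] dF_hom[OF r0 x] d2F_hom[OF r0 x] d3F_hom[OF r0 x])
    have pg: "pairing (gm (p, - 1)) H = 1 / r * pairing (gm x) H" for H
      by (simp add: pairing_def hom sum_divide_distrib)
    have pB: "pairing (Bm (p, - 1)) H = 1 / r\<^sup>2 * pairing (Bm x) H" for H
      by (simp add: pairing_def hom sum_divide_distrib)
    have tg: "trace_sq (gm (p, - 1)) H = 1 / r\<^sup>2 * trace_sq (gm x) H" for H
      by (simp add: trace_sq_def hom sum_divide_distrib[symmetric] power2_eq_square)
    have G: "0 < Gh e d" using r1(2) e d by simp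
    have "c \<le> F (p, - 1) * F00 (p, - 1)" using c(2)[of e d] e d r0 by (simp add: hom x_def)
    moreover have "a * (F0 (p, - 1) * pairing (gm (p, - 1)) H + F (p, - 1) * pairing (Bm (p, - 1)) H)
        - F (p, - 1) * trace_sq (gm (p, - 1)) H \<le> - (3 / 2) * a\<^sup>2 * F00 (p, - 1)"
      if H: "\<forall>i j. H i j = H j i" and HX: "\<forall>j. (\<Sum>i\<in>UNIV. Xv (p, - 1) i * H i j) = a * p $ j" for H a
    proof -
      define b where "b = a / Gh e d"
      have a: "a = b * Gh e d" using G by (simp add: b_def)
      define s where "s = b * r"
      have sd: "s * d = b" using dr by (simp add: s_def mult.commute)
      \<comment> \<open>Since X.e is \<open>Gh e d\<close> and h X = a p, removing this rank-one
        part leaves k X = 0.\<close>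
      define k :: "real^'n^'n" where "k = (\<chi> i j. H i j - s * (e $ i * e $ j))"
      have ks: "\<forall>i j. k $ i $ j = k $ j $ i" using H by (simp add: k_def mult.commute)
      have "(\<Sum>i\<in>UNIV. Xv x i * k $ i $ j) = 0" for j
      proof -
        have "(\<Sum>i\<in>UNIV. Xv x i * k $ i $ j) = (\<Sum>i\<in>UNIV. Xv x i * H i j) - s * e $ j * Gh e d"
          by (simp add: k_def Gh_def x_def right_diff_distrib sum_subtractf sum_distrib_left ac_simps)
        also have "\<dots> = 0" using HX by (simp add: hom pe a s_def)
        finally show ?thesis .
      qed
      then have "Phi e d b k \<le> 0" using r2(2)[THEN spec[of _ e], THEN spec[of _ d], THEN spec[of _ b], THEN spec[of _ k]] e d ks by (simp add: x_def)
      moreover have "Phi e d b k = a * (F0 x * pairing (gm x) H + F x * pairing (Bm x) H)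
          - F x * trace_sq (gm x) H + 3 / 2 * a\<^sup>2 * F00 x"
        unfolding x_def
        by (subst Phi_eq[OF e(2) sd, of k H]) (use ks in \<open>simp_all add: k_def a power_mult_distrib\<close>)
      \<comment> \<open>For fixed a and H every term has degree -1 in the covector, so one factor r
        undoes the scaling.\<close>
      moreover have "r * (a * (F0 (p, - 1) * pairing (gm (p, - 1)) H + F (p, - 1) * pairing (Bm (p, - 1)) H)
        - F (p, - 1) * trace_sq (gm (p, - 1)) H + 3 / 2 * a\<^sup>2 * F00 (p, - 1))
        = a * (F0 x * pairing (gm x) H + F x * pairing (Bm x) H)
          - F x * trace_sq (gm x) H + 3 / 2 * a\<^sup>2 * F00 x"
        unfolding pg pB tg hom using r0 by (simp add: field_simps power2_eq_square)
      ultimately have "a * (F0 (p, - 1) * pairing (gm (p, - 1)) H + F (p, - 1) * pairing (Bm (p, - 1)) H)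
        - F (p, - 1) * trace_sq (gm (p, - 1)) H + 3 / 2 * a\<^sup>2 * F00 (p, - 1) \<le> 0"
        using r0 by (metis mult_le_0_iff not_less)
      then show ?thesis by simp
    qed
    ultimately show ?thesis by blast
  qed
  then show ?thesis using c(1) S0' by blast
qed

end

section \<open>The maximum principle\<close>

lemma quad_second_derivative:
  fixes f :: "(real^'n) \<times> real \<Rightarrow> real"
  assumes S: "open S" and f: "Ck_on (Suc (Suc 0)) S f" and x: "x \<in> S"
  shows "pd (pd f (a, 0)) (b, 0) x = quad (\<lambda>i j. pd (pd f (phi i)) (phi j) x) (($) a) (($) b)"
  unfolding linear_horizontal_expansion[OF linear_pd_pd(1)[OF S f x], of a]
    linear_horizontal_expansion[OF linear_pd_pd(2)[OF S f x], of _ b] quad_def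
  by (subst sum.swap) (simp add: sum_distrib_left ac_simps)

lemma ui_eq: "ui u i = pd u (phi i)"
  by (simp add: ui_def phi_def fun_eq_iff)

lemma uij_eq: "uij u i j = pd (pd u (phi j)) (phi i)"
  by (simp add: uij_def ui_eq phi_def fun_eq_iff)

lemma ut_eq: "ut u = pd u phi0"
  by (simp add: ut_def phi0_def fun_eq_iff)

lemma sum_scale_phi: "(\<Sum>i\<in>UNIV. c i *\<^sub>R phi i) = (\<chi> i. c i, 0)"
  by (simp add: phi_def prod_eq_iff fst_sum snd_sum vec_eq_iff axis_def if_distrib cong: if_cong)

lemma nu_eq: "nu u q = (\<chi> i. ui u i q, - 1)"
  by (simp add: nu_def sum_scale_phi phi0_def)

lemma nu_nonzero: "nu u q \<noteq> 0"
  by (simp add: nu_eq prod_eq_iff)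

definition dnu :: "((real^'n) \<times> real \<Rightarrow> real) \<Rightarrow> (real^'n) \<times> real \<Rightarrow> (real^'n) \<times> real \<Rightarrow> (real^'n) \<times> real" where
  "dnu u d q = (\<chi> i. pd (ui u i) d q, 0)"

text \<open>\<open>U\<close> stands for an open neighbourhood of the closed time strip, so
  derivatives at the end times are ordinary two-sided ones.\<close>

locale C3_function =
  fixes u :: "(real^'n) \<times> real \<Rightarrow> real" and U
  assumes open_U: "open U" and C3: "Ck_on (Suc (Suc (Suc 0))) U u"
begin

lemma diff_u: "q \<in> U \<Longrightarrow> u differentiable (at q)"
  and diff_du: "q \<in> U \<Longrightarrow> pd u v differentiable (at q)"
  and diff_d2u: "q \<in> U \<Longrightarrow> pd (pd u v) w differentiable (at q)"
  using Ck_on_differentiable[OF C3 open_U] Ck_on_differentiable[OF Ck_on_pd[OF C3] open_U]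
    Ck_on_differentiable[OF Ck_on_pd[OF Ck_on_pd[OF C3]] open_U] by blast+

lemma has_derivative_nu:
  assumes "q \<in> U"
  shows "(nu u has_derivative (\<lambda>d. dnu u d q)) (at q)"
proof -
  have "((\<lambda>q. (\<Sum>i\<in>UNIV. ui u i q *\<^sub>R phi i) - phi0) has_derivative
     (\<lambda>d. (\<Sum>i\<in>UNIV. pd (ui u i) d q *\<^sub>R phi i) - 0)) (at q)"
    unfolding ui_eq
    by (intro has_derivative_diff has_derivative_sum has_derivative_scaleR_left has_derivative_const
        has_derivative_pd diff_du assms)
  then show ?thesis by (simp add: nu_def[abs_def] dnu_def sum_scale_phi)
qed

lemma has_derivative_comp_nu:
  assumes "q \<in> U" "f differentiable (at (nu u q))"
  shows "((\<lambda>q. f (nu u q)) has_derivative (\<lambda>d. pd f (dnu u d q) (nu u q))) (at q)"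
  by (rule has_derivative_compose[OF has_derivative_nu[OF assms(1)] has_derivative_pd[OF assms(2)]])

lemma symmetric_d2u: "q \<in> U \<Longrightarrow> pd (pd u v) w q = pd (pd u w) v q"
  by (rule pd_symmetric[OF open_U Ck_on_SucD[OF C3]])

lemma linear_du: "q \<in> U \<Longrightarrow> linear (\<lambda>d. pd u d q)"
  by (rule linear_pd[OF diff_u])

end

locale anisotropic_graph = anisotropy F + C3_function u U
  for F u :: "(real^'n) \<times> real \<Rightarrow> real" and U
begin

abbreviation "spd q \<equiv> F (nu u q)"

abbreviation "H q \<equiv> (\<lambda>i j. uij u i j q)"

lemma spd_pos: "spd q > 0"
  by (rule F_pos[OF nu_nonzero])

lemma spd_differentiable: "q \<in> U \<Longrightarrow> spd differentiable (at q)"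
  using has_derivative_comp_nu[OF _ F_diff[OF nu_nonzero]] unfolding differentiable_def by blast

lemma pd_spd:
  assumes "q \<in> U"
  shows "pd spd d q = (\<Sum>i\<in>UNIV. Xv (nu u q) i * pd (ui u i) d q)"
proof -
  have "pd spd d q = pd F (dnu u d q) (nu u q)"
    by (rule pd_eqI[OF has_derivative_comp_nu[OF assms F_diff[OF nu_nonzero]]])
  then show ?thesis by (simp add: dnu_def dF_horizontal[OF nu_nonzero] mult.commute)
qed

lemma H_sym: "q \<in> U \<Longrightarrow> H q i j = H q j i"
  unfolding uij_eq by (rule symmetric_d2u)

lemma dnu_horizontal:
  assumes q: "q \<in> U"
  shows "dnu u (z, 0) q = (\<chi> i. \<Sum>j\<in>UNIV. H q i j * z $ j, 0)"
proof -
  have "pd (ui u i) (z, 0) q = (\<Sum>j\<in>UNIV. H q i j * z $ j)" for i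
    unfolding ui_eq linear_horizontal_expansion[OF linear_pd[OF diff_du[OF q]]] H_sym[OF q, of i]
    by (simp add: uij_eq mult.commute)
  then show ?thesis by (simp add: dnu_def)
qed

text \<open>Product rule for the formula of \<open>pd_spd\<close>: differentiating X gives the D^2 F
  term, and differentiating Du gives the third derivatives of u that make up
  \<open>W\<close>.\<close>

lemma pd_pd_spd:
  assumes q: "q \<in> U"
  shows "((\<lambda>q. pd spd d q) has_derivative (\<lambda>d'. pd (pd F (dnu u d q)) (dnu u d' q) (nu u q)
    + (\<Sum>i\<in>UNIV. Xv (nu u q) i * pd (pd (ui u i) d) d' q))) (at q)"
proof -
  have "((\<lambda>q. \<Sum>i\<in>UNIV. Xv (nu u q) i * pd (ui u i) d q) has_derivative
    (\<lambda>d'. \<Sum>i\<in>UNIV. Xv (nu u q) i * pd (pd (ui u i) d) d' q + pd (pd F (phi i)) (dnu u d' q) (nu u q) * pd (ui u i) d q)) (at q)"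
    unfolding Xv_def ui_eq
    by (intro has_derivative_sum has_derivative_mult has_derivative_comp_nu q has_derivative_pd
        F_diff2 nu_nonzero diff_d2u)
  also have "(\<lambda>d'. \<Sum>i\<in>UNIV. Xv (nu u q) i * pd (pd (ui u i) d) d' q + pd (pd F (phi i)) (dnu u d' q) (nu u q) * pd (ui u i) d q)
     = (\<lambda>d'. pd (pd F (dnu u d q)) (dnu u d' q) (nu u q) + (\<Sum>i\<in>UNIV. Xv (nu u q) i * pd (pd (ui u i) d) d' q))"
    using linear_horizontal_expansion[OF linear_d2F(1)[OF nu_nonzero[of u q]], of "\<chi> i. pd (ui u i) d q"]
    by (simp add: dnu_def[of u d] sum.distrib mult.commute add.commute)
  finally show ?thesis
    by (rule has_derivative_transform_within_open[OF _ open_U q]) (simp add: pd_spd)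
qed

text \<open>All third derivatives of u that occur: X_k g_ij u_kij. The spatial and the temporal
  condition contain the same quantity, so it can be eliminated between them.\<close>

definition W :: "(real^'n) \<times> real \<Rightarrow> real" where
  "W q = (\<Sum>k\<in>UNIV. Xv (nu u q) k * pairing (gm (nu u q)) (\<lambda>i j. pd (pd (ui u k) (phi i)) (phi j) q))"

text \<open>The second-order conditions are summed over the rows of Z with g = Z^T Z; this turns
  second derivatives along rows into pairings with g.\<close>

lemma spatial_maximum:
  fixes B \<psi>' :: real
  assumes q: "q \<in> U" and first: "\<And>z. pd spd (z, 0) q = spd q * \<psi>' * pd u (z, 0) q"
    and second: "\<And>z. pd (pd spd (z, 0)) (z, 0) q
      \<le> spd q * B * (pd u (z, 0) q)\<^sup>2 + spd q * \<psi>' * pd (pd u (z, 0)) (z, 0) q"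
  shows "trace_sq (gm (nu u q)) (H q) + W q
    \<le> spd q * B * F00 (nu u q) + spd q * \<psi>' * pairing (gm (nu u q)) (H q)"
proof -
  define x where "x = nu u q"
  have x: "x \<noteq> 0" unfolding x_def by (rule nu_nonzero)
  define p where "p = (\<chi> i. ui u i q)"
  have xp: "x = (p, - 1)" by (simp add: x_def p_def nu_eq)
  from psd_decomposition[of "gm x", OF gm_sym[OF x] gm_psd[OF x]]
  obtain Z :: "'n \<Rightarrow> 'n \<Rightarrow> real" where Z: "\<And>i j. gm x i j = (\<Sum>m\<in>UNIV. Z m i * Z m j)" by auto
  define z where "z m = (\<chi> i. Z m i)" for m
  have z: "($) (z m) = Z m" for m by (simp add: z_def fun_eq_iff)
  have du: "pd u (z m, 0) q = (\<Sum>i\<in>UNIV. Z m i * p $ i)" for m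
    unfolding linear_horizontal_expansion[OF linear_du[OF q]] by (simp add: z p_def ui_eq)
  have d2u: "pd (pd u (z m, 0)) (z m, 0) q = quad (H q) (Z m) (Z m)" for m
    unfolding quad_second_derivative[OF open_U Ck_on_SucD[OF C3] q] z uij_eq
    by (simp add: symmetric_d2u[OF q])
  have d2: "pd (pd spd (z m, 0)) (z m, 0) q = quad (gm x) (\<lambda>i. \<Sum>j\<in>UNIV. H q i j * Z m j) (\<lambda>i. \<Sum>j\<in>UNIV. H q i j * Z m j)
      + (\<Sum>k\<in>UNIV. Xv x k * quad (\<lambda>i j. pd (pd (ui u k) (phi i)) (phi j) q) (Z m) (Z m))" for m
  proof -
    define h where "h = (\<chi> i. \<Sum>j\<in>UNIV. H q i j * Z m j)"
    have "dnu u (z m, 0) q = (h, 0)" unfolding dnu_horizontal[OF q] h_def by (simp add: z)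
    moreover have "pd (pd (ui u k) (z m, 0)) (z m, 0) q = quad (\<lambda>i j. pd (pd (ui u k) (phi i)) (phi j) q) (Z m) (Z m)" for k
      unfolding ui_eq quad_second_derivative[OF open_U Ck_on_pd[OF C3] q] z ..
    moreover have "($) h = (\<lambda>i. \<Sum>j\<in>UNIV. H q i j * Z m j)" by (simp add: h_def fun_eq_iff)
    ultimately show ?thesis
      using pd_eqI[OF pd_pd_spd[OF q]] quad_gm[OF x, of h h] by (simp add: x_def)
  qed
  have "(\<Sum>m\<in>UNIV. pd (pd spd (z m, 0)) (z m, 0) q)
    \<le> (\<Sum>m\<in>UNIV. spd q * B * (pd u (z m, 0) q)\<^sup>2 + spd q * \<psi>' * pd (pd u (z m, 0)) (z m, 0) q)"
    by (intro sum_mono second)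
  also have "\<dots> = spd q * B * quad (gm x) (($) p) (($) p) + spd q * \<psi>' * pairing (gm x) (H q)"
    by (simp add: du d2u sum.distrib sum_distrib_left[symmetric] quad_decomposition[of "gm x" Z, OF Z]
        pairing_decomposition[of "gm x" Z, OF Z] power2_eq_square)
  \<comment> \<open>The covector is (p, -1), so r = 1 in \<open>quad_gm_self\<close>.\<close>
  also have "quad (gm x) (($) p) (($) p) = F00 x"
    using quad_gm_self(1)[of p 1] x by (simp add: xp)
  also have "(\<Sum>m\<in>UNIV. pd (pd spd (z m, 0)) (z m, 0) q)
    = trace_sq (gm x) (H q) + (\<Sum>m\<in>UNIV. \<Sum>k\<in>UNIV. Xv x k * quad (\<lambda>i j. pd (pd (ui u k) (phi i)) (phi j) q) (Z m) (Z m))"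
    by (simp add: d2 sum.distrib trace_sq_decomposition[of "gm x" Z, OF Z H_sym[OF q]])
  also have "(\<Sum>m\<in>UNIV. \<Sum>k\<in>UNIV. Xv x k * quad (\<lambda>i j. pd (pd (ui u k) (phi i)) (phi j) q) (Z m) (Z m)) = W q"
    unfolding W_def pairing_decomposition[of "gm x" Z, OF Z] x_def[symmetric]
    by (subst sum.swap) (simp add: sum_distrib_left)
  finally show ?thesis by (simp add: x_def)
qed

text \<open>The time derivative of F(nu) is X.D(u_t), so the equation is differentiated in the
  single direction (X, 0). The first-order condition h X = a Du then evaluates every term except
  \<open>W\<close>.\<close>

lemma time_derivative_spd:
  fixes \<psi>' :: real
  assumes q: "q \<in> U" and line: "\<And>y. (y, snd q) \<in> U \<and> ut u (y, snd q)
      = spd (y, snd q) * pairing (gm (nu u (y, snd q))) (H (y, snd q))"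
    and first: "\<And>z. pd spd (z, 0) q = spd q * \<psi>' * pd u (z, 0) q"
  shows "pd spd phi0 q = spd q * \<psi>' * (F0 (nu u q) * pairing (gm (nu u q)) (H q)
      + spd q * pairing (Bm (nu u q)) (H q)) + spd q * W q"
    and "(\<Sum>i\<in>UNIV. Xv (nu u q) i * H q i j) = spd q * \<psi>' * ui u j q"
proof -
  define x where "x = nu u q"
  define a where "a = spd q * \<psi>'"
  have x: "x \<noteq> 0" unfolding x_def by (rule nu_nonzero)
  define p where "p = (\<chi> i. ui u i q)"
  have xp: "x = (p, - 1)" by (simp add: x_def p_def nu_eq)
  have p0: "(p, 0) = x + phi0" by (simp add: xp phi0_def)
  define X where "X = (\<chi> i. Xv x i)"
  define d where "d = (X, 0 :: real)"
  have XH: "(\<Sum>i\<in>UNIV. Xv x i * H q i j) = a * ui u j q" for j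
    using first[of "axis j 1"] pd_spd[OF q, of "phi j"] symmetric_d2u[OF q]
    by (simp add: x_def a_def uij_eq ui_eq phi_def)
  then show "(\<Sum>i\<in>UNIV. Xv (nu u q) i * H q i j) = spd q * \<psi>' * ui u j q"
    by (simp add: x_def a_def)
  \<comment> \<open>Along (X, 0) the covector moves by a times (p, 0) = x + phi0, so Euler's
    relation reduces D^3 F in this direction to B - g.\<close>
  have dnu_d: "dnu u d q = a *\<^sub>R (p, 0)"
    using XH H_sym[OF q] by (simp add: d_def dnu_horizontal[OF q] X_def p_def vec_eq_iff mult.commute)
  have du_d: "pd u d q = F x + F0 x"
  proof -
    have "pd u d q = pd F (p, 0) x"
      unfolding d_def linear_horizontal_expansion[OF linear_du[OF q]] dF_horizontal[OF x]
      by (simp add: X_def p_def ui_eq mult.commute)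
    then show ?thesis unfolding p0 by (simp add: linear_add[OF linear_dF[OF x]] Euler1[OF x] F0_def)
  qed
  have d3: "pd (pd (pd F (phi i)) (phi j)) (dnu u d q) x = a * (Bm x i j - gm x i j)" for i j
    unfolding dnu_d p0
    by (simp add: linear_scale[OF linear_d3F(3)[OF x]] linear_add[OF linear_d3F(3)[OF x]] Euler3[OF x] Bm_def gm_def
        del: scaleR_Pair)
  let ?R = "\<lambda>q. spd q * (\<Sum>i\<in>UNIV. \<Sum>j\<in>UNIV. gm (nu u q) i j * uij u i j q)"
  define D where "D = spd q * (\<Sum>i\<in>UNIV. \<Sum>j\<in>UNIV. gm x i j * pd (uij u i j) d q
        + pd (pd (pd F (phi i)) (phi j)) (dnu u d q) x * H q i j)
      + pd spd d q * (\<Sum>i\<in>UNIV. \<Sum>j\<in>UNIV. gm x i j * H q i j)"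
  have R: "(?R has_derivative (\<lambda>d. spd q * (\<Sum>i\<in>UNIV. \<Sum>j\<in>UNIV. gm (nu u q) i j * pd (uij u i j) d q
        + pd (pd (pd F (phi i)) (phi j)) (dnu u d q) (nu u q) * uij u i j q)
      + pd spd d q * (\<Sum>i\<in>UNIV. \<Sum>j\<in>UNIV. gm (nu u q) i j * uij u i j q))) (at q)"
    unfolding gm_def uij_eq
    by (intro has_derivative_mult has_derivative_sum has_derivative_pd[OF spd_differentiable] q
        has_derivative_comp_nu F_diff3 nu_nonzero has_derivative_pd[OF diff_d2u])
  have pdR: "pd ?R d q = D" unfolding D_def x_def by (rule pd_eqI[OF R])
  \<comment> \<open>The equation is known on this time slice only; that suffices because
    \<open>d\<close> is horizontal.\<close>
  have utd: "pd (ut u) d q = D"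
  proof (rule pd_eqI_line)
    show "ut u differentiable (at q)" unfolding ut_eq by (rule diff_du[OF q])
    have "?R differentiable (at q)" using R unfolding differentiable_def by blast
    then have "((\<lambda>s. ?R (q + s *\<^sub>R d)) has_real_derivative pd ?R d (q + 0 *\<^sub>R d)) (at 0)"
      by (intro pd_line) simp
    moreover have "?R (q + s *\<^sub>R d) = ut u (q + s *\<^sub>R d)" for s
    proof -
      have "q + s *\<^sub>R d = (fst q + s *\<^sub>R X, snd q)" by (simp add: d_def prod_eq_iff)
      then show ?thesis using line[of "fst q + s *\<^sub>R X"] by (simp add: pairing_def)
    qed
    ultimately show "((\<lambda>s. ut u (q + s *\<^sub>R d)) has_real_derivative D) (at 0)" using pdR by simp
  qed
  have third: "(\<Sum>i\<in>UNIV. \<Sum>j\<in>UNIV. gm x i j * pd (uij u i j) d q) = W q"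
  proof -
    have d3u: "pd (uij u i j) d q = (\<Sum>k\<in>UNIV. Xv x k * pd (pd (ui u k) (phi i)) (phi j) q)" for i j
    proof -
      have "pd (uij u i j) d q = (\<Sum>k\<in>UNIV. Xv x k * pd (pd (pd u (phi j)) (phi i)) (phi k) q)"
        unfolding d_def uij_eq linear_horizontal_expansion[OF linear_pd3(3)[OF open_U C3 q]]
        by (simp add: X_def)
      also have "\<dots> = (\<Sum>k\<in>UNIV. Xv x k * pd (pd (pd u (phi k)) (phi i)) (phi j) q)"
        using pd3_symmetric[OF open_U C3 q] by (intro sum.cong refl) metis
      finally show ?thesis by (simp add: ui_eq)
    qed
    have "(\<Sum>i\<in>UNIV. \<Sum>j\<in>UNIV. gm x i j * pd (uij u i j) d q)
      = (\<Sum>i\<in>UNIV. \<Sum>j\<in>UNIV. \<Sum>k\<in>UNIV. Xv x k * (gm x i j * pd (pd (ui u k) (phi i)) (phi j) q))"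
      unfolding d3u by (simp add: sum_distrib_left ac_simps)
    also have "\<dots> = (\<Sum>i\<in>UNIV. \<Sum>k\<in>UNIV. \<Sum>j\<in>UNIV. Xv x k * (gm x i j * pd (pd (ui u k) (phi i)) (phi j) q))"
      by (rule sum.cong[OF refl], subst sum.swap, rule refl)
    also have "\<dots> = (\<Sum>k\<in>UNIV. \<Sum>i\<in>UNIV. \<Sum>j\<in>UNIV. Xv x k * (gm x i j * pd (pd (ui u k) (phi i)) (phi j) q))"
      by (rule sum.swap)
    finally show ?thesis by (simp add: W_def pairing_def x_def sum_distrib_left)
  qed
  have "pd spd phi0 q = (\<Sum>i\<in>UNIV. Xv x i * pd (ut u) (phi i) q)"
    unfolding pd_spd[OF q] by (simp add: x_def ui_eq ut_eq symmetric_d2u[OF q, of _ phi0])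
  also have "\<dots> = pd (ut u) d q"
    unfolding d_def ut_eq linear_horizontal_expansion[OF linear_pd[OF diff_du[OF q]]] by (simp add: X_def)
  also have "\<dots> = spd q * (W q + a * (pairing (Bm x) (H q) - pairing (gm x) (H q))) + a * (F x + F0 x) * pairing (gm x) (H q)"
    unfolding utd D_def sum.distrib third d3
    using first[of X] du_d
    by (simp add: d_def a_def pairing_def sum_subtractf sum_distrib_left left_diff_distrib right_diff_distrib ac_simps)
  also have "F x = spd q" by (simp add: x_def)
  \<comment> \<open>The term -a F <g, h> from D^3 F cancels against +a F <g, h> from differentiating
    the factor F.\<close>
  finally show "pd spd phi0 q = spd q * \<psi>' * (F0 (nu u q) * pairing (gm (nu u q)) (H q)
      + spd q * pairing (Bm (nu u q)) (H q)) + spd q * W q"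
    by (simp add: x_def a_def algebra_simps)
qed

text \<open>Only the slice at \<open>t\<close> and earlier times over \<open>y\<close> are compared,
  so the maximum may sit at the end of the time interval; the time condition is accordingly
  one-sided.\<close>

lemma barrier_not_touched:
  fixes A M \<sigma> c t :: real
  assumes U: "\<And>y. (y, t) \<in> U"
    and pde: "\<And>y. ut u (y, t) = spd (y, t) * pairing (gm (nu u (y, t))) (H (y, t))"
    and t: "t > 0" and \<sigma>: "\<sigma>\<^sup>2 = 1" and A: "A > 0" "2 \<le> A * c"
    and small: "t < A * (2 * M - \<sigma> * u (y, t))\<^sup>2 / 2"
    and space: "\<And>y'. ln (spd (y', t)) - A * (2 * M - \<sigma> * u (y', t))\<^sup>2 / (2 * t)
      \<le> ln (spd (y, t)) - A * (2 * M - \<sigma> * u (y, t))\<^sup>2 / (2 * t)"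
    and time: "e > 0" "\<And>s. 0 < s \<Longrightarrow> s < e \<Longrightarrow>
      ln (spd (y, t - s)) - ln (t - s) - A * (2 * M - \<sigma> * u (y, t - s))\<^sup>2 / (2 * (t - s))
      \<le> ln (spd (y, t)) - ln t - A * (2 * M - \<sigma> * u (y, t))\<^sup>2 / (2 * t)"
    and c: "c \<le> spd (y, t) * F00 (nu u (y, t))"
    and algebra: "\<And>a. (\<forall>j. (\<Sum>i\<in>UNIV. Xv (nu u (y, t)) i * H (y, t) i j) = a * ui u j (y, t)) \<Longrightarrow>
      a * (F0 (nu u (y, t)) * pairing (gm (nu u (y, t))) (H (y, t)) + spd (y, t) * pairing (Bm (nu u (y, t))) (H (y, t)))
        - spd (y, t) * trace_sq (gm (nu u (y, t))) (H (y, t)) \<le> - (3 / 2) * a\<^sup>2 * F00 (nu u (y, t))"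
  shows False
proof -
  define q where "q = (y, t)"
  define v where "v = spd q"
  define b where "b = 2 * M - \<sigma> * u q"
  \<comment> \<open>Partial derivatives of psi in u and in t; the second derivative in u is A / t
    because \<sigma> squares to 1.\<close>
  define \<psi>' where "\<psi>' = - \<sigma> * A * b / t"
  define \<psi>t where "\<psi>t = 1 / t - A * b\<^sup>2 / (2 * t\<^sup>2)"
  note sp = space[folded q_def] and ti = time[folded q_def]
  have q: "q \<in> U" using U by (simp add: q_def)
  have v: "v > 0" unfolding v_def by (rule spd_pos)
  have line: "q + s *\<^sub>R (z, 0) = (y + s *\<^sub>R z, t)" for s z by (simp add: q_def)
  have lineU: "q + s *\<^sub>R (z, 0) \<in> U" for s z unfolding line by (rule U)
  have spatial: "pd spd (z, 0) q = v * \<psi>' * pd u (z, 0) q"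
    "pd (pd spd (z, 0)) (z, 0) q \<le> v * (A / t + \<psi>'\<^sup>2) * (pd u (z, 0) q)\<^sup>2 + v * \<psi>' * pd (pd u (z, 0)) (z, 0) q" for z
  proof -
    define d where "d = (z, 0 :: real)"
    let ?l = "\<lambda>s. q + s *\<^sub>R d"
    let ?g = "\<lambda>s. ln (spd (?l s)) - A * (2 * M - \<sigma> * u (?l s))\<^sup>2 / (2 * t)"
    let ?g1 = "\<lambda>s. pd spd d (?l s) / spd (?l s) + \<sigma> * A * (2 * M - \<sigma> * u (?l s)) / t * pd u d (?l s)"
    let ?g2 = "pd (pd spd d) d q / v - (pd spd d q)\<^sup>2 / v\<^sup>2 - \<psi>' * pd (pd u d) d q - A / t * (pd u d q)\<^sup>2"
    have lU: "?l s \<in> U" for s unfolding d_def by (rule lineU)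
    have dd: "pd spd d differentiable (at (?l s))" for s
      using pd_pd_spd[OF lU, of d s] unfolding differentiable_def by blast
    have D: "((\<lambda>s. spd (?l s)) has_real_derivative pd spd d (?l s)) (at s)"
      "((\<lambda>s. u (?l s)) has_real_derivative pd u d (?l s)) (at s)"
      "((\<lambda>s. pd u d (?l s)) has_real_derivative pd (pd u d) d (?l s)) (at s)"
      "((\<lambda>s. pd spd d (?l s)) has_real_derivative pd (pd spd d) d (?l s)) (at s)" for s
      by (intro pd_line spd_differentiable diff_u diff_du dd lU)+
    have g1: "(?g has_real_derivative ?g1 s) (at s)" for s
      by (rule derivative_eq_intros D refl spd_pos | use t in \<open>simp add: field_simps\<close>)+
    have g2: "(?g1 has_real_derivative ?g2) (at 0)"
    proof -
      have "(?g1 has_real_derivative (pd (pd spd d) d (?l 0) * spd (?l 0) - pd spd d (?l 0) * pd spd d (?l 0)) / (spd (?l 0) * spd (?l 0))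
        + (\<sigma> * A * (0 - \<sigma> * pd u d (?l 0)) / t * pd u d (?l 0) + pd (pd u d) d (?l 0) * (\<sigma> * A * (2 * M - \<sigma> * u (?l 0)) / t))) (at 0)"
        using spd_pos[of "?l 0"]
        by (intro DERIV_add DERIV_divide DERIV_mult DERIV_cdivide DERIV_cmult DERIV_diff DERIV_const D) simp
      also have "(pd (pd spd d) d (?l 0) * spd (?l 0) - pd spd d (?l 0) * pd spd d (?l 0)) / (spd (?l 0) * spd (?l 0))
        + (\<sigma> * A * (0 - \<sigma> * pd u d (?l 0)) / t * pd u d (?l 0) + pd (pd u d) d (?l 0) * (\<sigma> * A * (2 * M - \<sigma> * u (?l 0)) / t))
        = pd (pd spd d) d q / v - (pd spd d q)\<^sup>2 / v\<^sup>2 - \<psi>' * pd (pd u d) d q - \<sigma>\<^sup>2 * A / t * (pd u d q)\<^sup>2"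
        using v by (simp add: v_def[symmetric] b_def \<psi>'_def diff_divide_distrib power2_eq_square ac_simps)
      finally show ?thesis by (simp add: \<sigma>)
    qed
    have mx: "?g s \<le> ?g 0" for s using sp[of "y + s *\<^sub>R z"] unfolding d_def line by (simp add: q_def)
    from second_derivative_at_max[OF zero_less_one g1 g2 mx]
    have 1: "pd spd d q / v - \<psi>' * pd u d q = 0" and 2: "?g2 \<le> 0"
      by (simp_all add: v_def[symmetric] b_def[symmetric] \<psi>'_def)
    from 1 v have 3: "pd spd d q = v * \<psi>' * pd u d q" by (simp add: field_simps)
    then show "pd spd (z, 0) q = v * \<psi>' * pd u (z, 0) q" by (simp add: d_def)
    have "pd (pd spd d) d q / v \<le> (A / t + \<psi>'\<^sup>2) * (pd u d q)\<^sup>2 + \<psi>' * pd (pd u d) d q"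
      using 2 v unfolding 3 by (simp add: power_mult_distrib algebra_simps)
    then have "pd (pd spd d) d q \<le> ((A / t + \<psi>'\<^sup>2) * (pd u d q)\<^sup>2 + \<psi>' * pd (pd u d) d q) * v"
      using v by (simp add: pos_divide_le_eq)
    then show "pd (pd spd (z, 0)) (z, 0) q \<le> v * (A / t + \<psi>'\<^sup>2) * (pd u (z, 0) q)\<^sup>2 + v * \<psi>' * pd (pd u (z, 0)) (z, 0) q"
      by (simp add: d_def algebra_simps)
  qed
  define x where "x = nu u q"
  define gH where "gH = pairing (gm x) (H q)"
  define BH where "BH = pairing (Bm x) (H q)"
  define T where "T = trace_sq (gm x) (H q)"
  have space': "T + W q \<le> v * (A / t + \<psi>'\<^sup>2) * F00 x + v * \<psi>' * gH"
    using spatial_maximum[OF q spatial[unfolded v_def]] by (simp add: x_def gH_def T_def v_def)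
  have time': "pd spd phi0 q = v * \<psi>' * (F0 x * gH + v * BH) + v * W q"
    and XH: "(\<Sum>i\<in>UNIV. Xv x i * H q i j) = v * \<psi>' * ui u j q" for j
    using time_derivative_spd[OF q _ spatial(1)[unfolded v_def]] U pde
    by (simp_all add: x_def gH_def BH_def v_def q_def)
  have ut: "pd u phi0 q = v * gH"
    using pde[of y] by (simp add: ut_eq q_def v_def gH_def x_def)
  have "v * (\<psi>t + \<psi>' * (v * gH)) \<le> pd spd phi0 q"
  proof -
    let ?h = "\<lambda>s. ln (spd (q + s *\<^sub>R phi0)) - ln (t + s) - A * (2 * M - \<sigma> * u (q + s *\<^sub>R phi0))\<^sup>2 / (2 * (t + s))"
    have D: "((\<lambda>s. spd (q + s *\<^sub>R phi0)) has_real_derivative pd spd phi0 q) (at 0)"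
      "((\<lambda>s. u (q + s *\<^sub>R phi0)) has_real_derivative pd u phi0 q) (at 0)"
      using pd_line[of spd q 0 phi0 UNIV] pd_line[of u q 0 phi0 UNIV] spd_differentiable[OF q] diff_u[OF q] by simp_all
    have h: "(?h has_real_derivative pd spd phi0 q / v - \<psi>t - \<psi>' * pd u phi0 q) (at 0)"
    proof -
      have "((\<lambda>s. ln (spd (q + s *\<^sub>R phi0))) has_real_derivative pd spd phi0 q / v) (at 0)"
        by (rule derivative_eq_intros D refl)+ (use v in \<open>simp_all add: v_def D\<close>)
      moreover have "((\<lambda>s. ln (t + s)) has_real_derivative 1 / t) (at 0)"
        by (rule derivative_eq_intros refl | use t in simp)+
      moreover have "((\<lambda>s. A * (2 * M - \<sigma> * u (q + s *\<^sub>R phi0))\<^sup>2 / (2 * (t + s))) has_real_derivative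
          \<psi>' * pd u phi0 q - A * b\<^sup>2 / (2 * t\<^sup>2)) (at 0)"
        by (rule derivative_eq_intros D refl | use t in \<open>simp add: b_def \<psi>'_def field_simps power2_eq_square\<close>)+
      ultimately have "(?h has_real_derivative pd spd phi0 q / v - 1 / t - (\<psi>' * pd u phi0 q - A * b\<^sup>2 / (2 * t\<^sup>2))) (at 0)"
        by (intro DERIV_diff)
      then show ?thesis by (simp add: \<psi>t_def algebra_simps)
    qed
    have "0 \<le> pd spd phi0 q / v - \<psi>t - \<psi>' * pd u phi0 q"
    proof (rule ccontr)
      assume "\<not> ?thesis"
      then obtain e' where e': "e' > 0" "\<And>s. 0 < s \<Longrightarrow> s < e' \<Longrightarrow> ?h 0 < ?h (0 - s)"
        using DERIV_neg_dec_left[OF h] by auto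
      define s where "s = min e e' / 2"
      have s: "0 < s" "s < e" "s < e'" using e'(1) time(1) by (auto simp: s_def)
      have "q + (- s) *\<^sub>R phi0 = (y, t - s)" by (simp add: q_def phi0_def)
      then show False using e'(2)[OF s(1,3)] ti(2)[OF s(1,2)] by (simp add: q_def)
    qed
    then have "\<psi>t + \<psi>' * (v * gH) \<le> pd spd phi0 q / v" by (simp add: ut)
    then show ?thesis using v by (simp add: pos_le_divide_eq mult.commute)
  qed
  also have "\<dots> \<le> v * \<psi>' * (F0 x * gH + v * BH) + v * (v * (A / t + \<psi>'\<^sup>2) * F00 x + v * \<psi>' * gH - T)"
    unfolding time' using space' v by (simp add: mult_left_mono)
  also have "\<dots> = v * \<psi>' * (F0 x * gH + v * BH) - v * T + v\<^sup>2 * (A / t + \<psi>'\<^sup>2) * F00 x + v * (\<psi>' * (v * gH))"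
    by (simp add: algebra_simps power2_eq_square)
  also have "v * \<psi>' * (F0 x * gH + v * BH) - v * T \<le> - (3 / 2) * (v * \<psi>')\<^sup>2 * F00 x"
    using algebra[folded q_def, of "v * \<psi>'"] XH by (simp add: x_def gH_def BH_def T_def v_def)
  \<comment> \<open>The coefficients of the square of \<psi>' add up to 1 - 3/2 = -1/2.\<close>
  finally have "v * \<psi>t \<le> v * (v * F00 x * (A / t - \<psi>'\<^sup>2 / 2))"
    by (simp add: algebra_simps power2_eq_square)
  then have *: "\<psi>t \<le> v * F00 x * (A / t - \<psi>'\<^sup>2 / 2)" using v by simp
  have "\<psi>'\<^sup>2 = A * (A * b\<^sup>2 / t\<^sup>2)"
    using \<sigma> by (simp add: \<psi>'_def power_mult_distrib power_divide power2_eq_square)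
  \<comment> \<open>This identity is the reason for the shape of psi: the term ln t supplies the 1 /
    t that matches A / t.\<close>
  then have eq: "A / t - \<psi>'\<^sup>2 / 2 = A * \<psi>t" by (simp add: \<psi>t_def algebra_simps)
  have neg: "\<psi>t < 0"
    using small[folded q_def, folded b_def] t by (simp add: \<psi>t_def field_simps power2_eq_square)
  have "2 \<le> A * (v * F00 x)"
    using order_trans[OF A(2) mult_left_mono[OF c[folded q_def] less_imp_le[OF A(1)]]]
    by (simp add: v_def x_def)
  \<comment> \<open>Multiplying by a negative number reverses the inequality; what remains is
    \<psi>t <= 2 \<psi>t with \<psi>t < 0.\<close>
  then have "A * (v * F00 x) * \<psi>t \<le> 2 * \<psi>t" using neg by (intro mult_right_mono_neg) auto
  with * neg show False unfolding eq by (simp add: ac_simps)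
qed

end

text \<open>Removing the integer parts of the coordinates leaves a point of the fundamental
  parallelepiped. With periodicity, a supremum over all of space becomes one over a ball.\<close>

lemma lattice_bounded_representatives:
  fixes L :: "(real^'n) set"
  assumes "lattice L"
  obtains R where "\<And>y. \<exists>l\<in>L. norm (y + l) \<le> R"
proof -
  obtain b :: "'n \<Rightarrow> real^'n" where b: "inj b" "independent (range b)"
    and L: "L = {(\<Sum>i\<in>UNIV. of_int (k i) *\<^sub>R b i) | k :: 'n \<Rightarrow> int. True}"
    using assms unfolding lattice_def by blast
  have "card (range b) = DIM(real^'n)" using b(1) by (simp add: card_image)
  then have span: "span (range b) = UNIV"
    using card_ge_dim_independent[of "range b" UNIV] b(2) by auto
  have "\<exists>l\<in>L. norm (y + l) \<le> (\<Sum>i\<in>UNIV. norm (b i))" for y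
  proof -
    have "y \<in> span (range b)" by (simp add: span)
    then obtain c where "y = (\<Sum>v\<in>range b. c v *\<^sub>R v)" by (auto simp: span_finite)
    then have y: "y = (\<Sum>i\<in>UNIV. c (b i) *\<^sub>R b i)" by (simp add: sum.reindex[OF b(1)])
    define l where "l = (\<Sum>i\<in>UNIV. of_int (- \<lfloor>c (b i)\<rfloor>) *\<^sub>R b i)"
    have "l \<in> L" unfolding L l_def by (intro CollectI exI[of _ "\<lambda>i. - \<lfloor>c (b i)\<rfloor>"]) simp
    moreover have "y + l = (\<Sum>i\<in>UNIV. frac (c (b i)) *\<^sub>R b i)"
      by (simp add: y l_def frac_def scaleR_diff_left sum_subtractf sum_negf)
    then have "norm (y + l) \<le> (\<Sum>i\<in>UNIV. norm (b i))"
      by (simp only:) (intro sum_norm_le, simp add: frac_ge_0 abs_of_nonneg mult_left_le_one_le less_imp_le frac_lt_1)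
    ultimately show ?thesis by blast
  qed
  then show thesis by (rule that)
qed

text \<open>Bounds t exp(K / t) below by K^2 / (2 t) for K >= 0: enough for blow-up as t tends to 0
  and for an explicit time bound.\<close>

lemma exp_ge_half_square: "x \<ge> 0 \<Longrightarrow> x\<^sup>2 / 2 \<le> exp (x :: real)"
  using exp_lower_Taylor_quadratic[of x] by linarith

section \<open>Comparison with the barrier for periodic solutions\<close>

context anisotropic_graph
begin

lemma nu_periodic:
  assumes U: "(y, t) \<in> U" "(y + l, t) \<in> U" and per: "\<And>y. u (y + l, t) = u (y, t)"
  shows "nu u (y + l, t) = nu u (y, t)"
proof -
  have "ui u i (y + l, t) = ui u i (y, t)" for i
    unfolding ui_eq
  proof (rule pd_eqI_line[OF diff_u[OF U(2)]])
    have "((\<lambda>s. u ((y, t) + s *\<^sub>R phi i)) has_real_derivative pd u (phi i) ((y, t) + 0 *\<^sub>R phi i)) (at 0)"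
      using diff_u[OF U(1)] by (intro pd_line) simp
    moreover have "u ((y, t) + s *\<^sub>R phi i) = u ((y + l, t) + s *\<^sub>R phi i)" for s
      using per[of "y + s *\<^sub>R axis i 1"] by (simp add: phi_def ac_simps)
    ultimately show "((\<lambda>s. u ((y + l, t) + s *\<^sub>R phi i)) has_real_derivative pd u (phi i) (y, t)) (at 0)"
      by simp
  qed
  then show ?thesis by (simp add: nu_eq)
qed

lemma continuous_on_spd: "continuous_on U spd"
  by (intro continuous_at_imp_continuous_on ballI differentiable_imp_continuous_within spd_differentiable)

lemma continuous_on_u: "continuous_on U u"
  by (intro continuous_at_imp_continuous_on ballI differentiable_imp_continuous_within diff_u)

text \<open>The barrier tends to infinity as \<open>t \<longrightarrow> 0\<close>, so the positive supremum of the logarithmic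
  difference is attained at a positive time, and by periodicity at a bounded point.\<close>
lemma spd_le_barrier:
  fixes A M \<sigma> c S T t1 :: real
  assumes U: "UNIV \<times> {0..T} \<subseteq> U"
    and pde: "\<And>y t. 0 \<le> t \<Longrightarrow> t \<le> T \<Longrightarrow> ut u (y, t) = spd (y, t) * pairing (gm (nu u (y, t))) (H (y, t))"
    and M: "M > 0" "\<And>y t. 0 \<le> t \<Longrightarrow> t \<le> T \<Longrightarrow> \<bar>u (y, t)\<bar> \<le> M"
    and L: "lattice L" "\<And>l y t. l \<in> L \<Longrightarrow> 0 \<le> t \<Longrightarrow> t \<le> T \<Longrightarrow> u (y + l, t) = u (y, t)"
    and \<sigma>: "\<sigma> = 1 \<or> \<sigma> = - 1" and A: "A > 0" "2 \<le> A * c" and S: "S > 0"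
    and t1: "0 < t1" "t1 \<le> T" "t1 \<le> A * M\<^sup>2 / 4" "t1 \<le> A\<^sup>2 * M ^ 4 / (8 * S)"
    and algebra: "\<And>p. S \<le> F (p, - 1) \<Longrightarrow> c \<le> F (p, - 1) * F00 (p, - 1) \<and>
      (\<forall>H a. (\<forall>i j. H i j = H j i) \<longrightarrow> (\<forall>j. (\<Sum>i\<in>UNIV. Xv (p, - 1) i * H i j) = a * p $ j) \<longrightarrow>
        a * (F0 (p, - 1) * pairing (gm (p, - 1)) H + F (p, - 1) * pairing (Bm (p, - 1)) H)
          - F (p, - 1) * trace_sq (gm (p, - 1)) H \<le> - (3 / 2) * a\<^sup>2 * F00 (p, - 1))"
  shows "spd (y1, t1) \<le> t1 * exp (A * (2 * M - \<sigma> * u (y1, t1))\<^sup>2 / (2 * t1))"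
proof (rule ccontr)
  define b where "b q = 2 * M - \<sigma> * u q" for q
  define Z where "Z q = ln (spd q) - ln (snd q) - A * (b q)\<^sup>2 / (2 * snd q)" for q
  have inU: "(y, t) \<in> U" if "0 \<le> t" "t \<le> T" for y t using U that by auto
  \<comment> \<open>The shift by 2 M makes \<open>b\<close> at least M when |u| <= M, so the
    exponent never degenerates.\<close>
  have b: "M\<^sup>2 \<le> (b (y, t))\<^sup>2" if "0 \<le> t" "t \<le> T" for y t
  proof (rule power_mono)
    show "M \<le> b (y, t)" using M(2)[OF that, of y] \<sigma> by (auto simp: b_def abs_le_iff)
  qed (use M in simp)
  have Z_pos: "0 < Z (y, t) \<longleftrightarrow> t * exp (A * (b (y, t))\<^sup>2 / (2 * t)) < spd (y, t)"
    and Z_neg: "0 \<ge> Z (y, t) \<longleftrightarrow> spd (y, t) \<le> t * exp (A * (b (y, t))\<^sup>2 / (2 * t))" if "0 < t" for y t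
  proof -
    have "ln (t * exp (A * (b (y, t))\<^sup>2 / (2 * t))) = ln t + A * (b (y, t))\<^sup>2 / (2 * t)"
      using that by (simp add: ln_mult)
    moreover have "ln (t * exp (A * (b (y, t))\<^sup>2 / (2 * t))) < ln (spd (y, t)) \<longleftrightarrow>
        t * exp (A * (b (y, t))\<^sup>2 / (2 * t)) < spd (y, t)"
      using that spd_pos by (intro ln_less_cancel_iff) auto
    ultimately show 1: "0 < Z (y, t) \<longleftrightarrow> t * exp (A * (b (y, t))\<^sup>2 / (2 * t)) < spd (y, t)"
      unfolding Z_def by auto
    then show "0 \<ge> Z (y, t) \<longleftrightarrow> spd (y, t) \<le> t * exp (A * (b (y, t))\<^sup>2 / (2 * t))"
      by (simp add: not_less[symmetric])
  qed
  \<comment> \<open>This is K^2 / (2 t) with K = A M^2 / 2, the origin of the second time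
    bound.\<close>
  have barrier: "A\<^sup>2 * M ^ 4 / (8 * t) \<le> t * exp (A * (b (y, t))\<^sup>2 / (2 * t))" if t: "0 < t" "t \<le> T" for y t
  proof -
    have "A\<^sup>2 * M ^ 4 / (8 * t) = t * ((A * M\<^sup>2 / (2 * t))\<^sup>2 / 2)"
      using t by (simp add: field_simps power2_eq_square) (simp add: eval_nat_numeral)
    also have "\<dots> \<le> t * exp (A * M\<^sup>2 / (2 * t))"
      using t A by (intro mult_left_mono exp_ge_half_square) auto
    also have "\<dots> \<le> t * exp (A * (b (y, t))\<^sup>2 / (2 * t))"
      using t A b[of t y] by (intro mult_left_mono) (auto intro!: divide_right_mono mult_left_mono)
    finally show ?thesis .
  qed
  obtain R where R: "\<And>y. \<exists>l\<in>L. norm (y + l) \<le> R" using lattice_bounded_representatives[OF L(1)] by blast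
  define r where "r y = y + (SOME l. l \<in> L \<and> norm (y + l) \<le> R)" for y
  have r: "norm (r y) \<le> R" "\<exists>l\<in>L. r y = y + l" for y
    using someI_ex[of "\<lambda>l. l \<in> L \<and> norm (y + l) \<le> R"] R[of y] unfolding r_def by blast+
  have periodic: "spd (r y, t) = spd (y, t)" "Z (r y, t) = Z (y, t)" if "0 \<le> t" "t \<le> T" for y t
  proof -
    obtain l where l: "l \<in> L" "r y = y + l" using r(2) by blast
    have "nu u (y + l, t) = nu u (y, t)"
      by (rule nu_periodic) (use inU that L(2)[OF l(1)] in auto)
    then show "spd (r y, t) = spd (y, t)" "Z (r y, t) = Z (y, t)"
      using l L(2)[OF l(1)] that by (simp_all add: Z_def b_def)
  qed
  assume "\<not> ?thesis"
  then have Z1: "Z (y1, t1) > 0" using Z_pos[OF t1(1), of y1] by (simp add: b_def)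
  have "compact (spd ` (cball 0 R \<times> {0..T}))"
    by (intro compact_continuous_image continuous_on_subset[OF continuous_on_spd] compact_Times) (use U in auto)
  then have "bdd_above (spd ` (cball 0 R \<times> {0..T}))"
    by (intro bounded_imp_bdd_above compact_imp_bounded)
  then obtain V where "\<forall>a\<in>spd ` (cball 0 R \<times> {0..T}). a \<le> V" unfolding bdd_above_def ..
  then have V: "spd q \<le> V" if "q \<in> cball 0 R \<times> {0..T}" for q using that by blast
  have V': "spd (y, t) \<le> V" if "0 \<le> t" "t \<le> T" for y t
    using V[of "(r y, t)"] periodic(1)[OF that, of y] r(1)[of y] that by simp
  have Vpos: "V > 0" using V'[of t1 y1] spd_pos[of "(y1, t1)"] t1 by simp
  \<comment> \<open>Before \<open>t0\<close> the barrier exceeds the supremum \<open>V\<close> of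
    F(nu). This time depends on u, but it only secures a maximum at positive time and does not enter
    the result.\<close>
  define t0 where "t0 = min t1 (A\<^sup>2 * M ^ 4 / (8 * V))"
  have t0: "0 < t0" "t0 \<le> t1" using t1 A M Vpos by (auto simp: t0_def)
  have early: "Z (y, t) \<le> 0" if "0 < t" "t \<le> t0" for y t
  proof -
    have "t * (8 * V) \<le> A\<^sup>2 * M ^ 4"
      using that Vpos by (simp add: t0_def pos_le_divide_eq)
    then have "V \<le> A\<^sup>2 * M ^ 4 / (8 * t)" using that by (simp add: field_simps)
    also have "\<dots> \<le> t * exp (A * (b (y, t))\<^sup>2 / (2 * t))" using that t0 t1 by (intro barrier) auto
    finally have "spd (y, t) \<le> t * exp (A * (b (y, t))\<^sup>2 / (2 * t))" using V'[of t y] that t0 t1 by simp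
    then show ?thesis using Z_neg that by simp
  qed
  let ?K = "cball (0 :: real^'n) R \<times> {t0..t1}"
  have KU: "?K \<subseteq> U" using inU t0 t1 by auto
  have "continuous_on ?K Z"
    unfolding Z_def b_def using t0 spd_pos
    by (intro continuous_intros continuous_on_subset[OF continuous_on_spd KU] continuous_on_subset[OF continuous_on_u KU])
      (auto simp: less_imp_neq[THEN not_sym])
  moreover have "compact ?K" by (intro compact_Times) auto
  moreover have "?K \<noteq> {}"
    using order_trans[OF norm_ge_zero r(1)[of 0]] t0 by auto
  ultimately obtain q where q: "q \<in> ?K" and qmax: "\<And>q'. q' \<in> ?K \<Longrightarrow> Z q' \<le> Z q"
    using continuous_attains_sup[of ?K Z] by blast
  obtain y t where yt: "q = (y, t)" by (cases q)
  have tt: "t0 \<le> t" "t \<le> t1" using q by (auto simp: yt)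
  have max: "Z (y', t') \<le> Z (y, t)" if "t0 \<le> t'" "t' \<le> t1" for y' t'
    using qmax[of "(r y', t')"] periodic(2)[of t' y'] r(1)[of y'] that t0 t1 by (simp add: yt)
  have Zpos: "Z (y, t) > 0" using max[of t1 y1] Z1 t0 by simp
  then have "\<not> t \<le> t0" using early[of t y] tt t0 by auto
  then have t: "t0 < t" "0 < t" "t \<le> T" using t0 tt t1 by auto
  define p where "p = (\<chi> i. ui u i (y, t))"
  have nu: "nu u (y, t) = (p, - 1)" by (simp add: p_def nu_eq)
  \<comment> \<open>The time bound puts the barrier above \<open>S\<close>, and F(nu) is above the
    barrier at the maximum, so the algebraic estimate is available there.\<close>
  have "S \<le> A\<^sup>2 * M ^ 4 / (8 * t)"
  proof -
    have "t * (8 * S) \<le> t1 * (8 * S)" using tt S by simp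
    also have "\<dots> \<le> A\<^sup>2 * M ^ 4" using t1(4) S by (simp add: pos_le_divide_eq)
    finally have "t * (8 * S) \<le> A\<^sup>2 * M ^ 4" .
    then show ?thesis using t by (simp add: field_simps)
  qed
  also have "\<dots> \<le> t * exp (A * (b (y, t))\<^sup>2 / (2 * t))" by (rule barrier[OF t(2,3)])
  also have "\<dots> < spd (y, t)" using Zpos Z_pos[OF t(2)] by simp
  finally have Sle: "S \<le> F (p, - 1)" by (simp add: nu)
  show False
  proof (rule barrier_not_touched[where t = t and A = A and c = c and M = M and \<sigma> = \<sigma> and y = y and e = "t - t0"])
    show "(y', t) \<in> U" for y' using inU t by simp
    show "ut u (y', t) = spd (y', t) * pairing (gm (nu u (y', t))) (H (y', t))" for y' using pde t by simp
    show "\<sigma>\<^sup>2 = 1" using \<sigma> by auto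
    show "t < A * (2 * M - \<sigma> * u (y, t))\<^sup>2 / 2"
    proof -
      \<comment> \<open>A quarter in the time bound against the half required here gives the strict
        inequality behind psi_t < 0.\<close>
      have "t \<le> A * M\<^sup>2 / 4" using tt t1 by simp
      also have "\<dots> < A * M\<^sup>2 / 2" using A M by simp
      also have "\<dots> \<le> A * (b (y, t))\<^sup>2 / 2" using A b[of t y] t by simp
      finally show ?thesis by (simp add: b_def)
    qed
    show "ln (spd (y', t)) - A * (2 * M - \<sigma> * u (y', t))\<^sup>2 / (2 * t)
      \<le> ln (spd (y, t)) - A * (2 * M - \<sigma> * u (y, t))\<^sup>2 / (2 * t)" for y'
      using max[OF tt, of y'] by (simp add: Z_def b_def)
    show "ln (spd (y, t - s)) - ln (t - s) - A * (2 * M - \<sigma> * u (y, t - s))\<^sup>2 / (2 * (t - s))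
      \<le> ln (spd (y, t)) - ln t - A * (2 * M - \<sigma> * u (y, t))\<^sup>2 / (2 * t)" if "0 < s" "s < t - t0" for s
      using max[of "t - s" y] that tt by (simp add: Z_def b_def)
    show "c \<le> spd (y, t) * F00 (nu u (y, t))" using algebra[OF Sle] by (simp add: nu)
    show "a * (F0 (nu u (y, t)) * pairing (gm (nu u (y, t))) (H (y, t)) + spd (y, t) * pairing (Bm (nu u (y, t))) (H (y, t)))
        - spd (y, t) * trace_sq (gm (nu u (y, t))) (H (y, t)) \<le> - (3 / 2) * a\<^sup>2 * F00 (nu u (y, t))"
      if "\<forall>j. (\<Sum>i\<in>UNIV. Xv (nu u (y, t)) i * H (y, t) i j) = a * ui u j (y, t)" for a
    proof -
      have "\<forall>i j. H (y, t) i j = H (y, t) j i" using H_sym inU t by simp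
      moreover have "\<forall>j. (\<Sum>i\<in>UNIV. Xv (p, - 1) i * H (y, t) i j) = a * p $ j"
        using that by (simp add: nu p_def)
      ultimately show ?thesis
        unfolding nu
        by (rule algebra[OF Sle, THEN conjunct2, THEN spec[of _ "H (y, t)"], THEN spec[of _ a], THEN mp, THEN mp])
    qed
  qed (use t A in auto)
qed

end

theorem theorem2:
  fixes F :: "(real^'n) \<times> real \<Rightarrow> real"
  assumes "standing_assumptions F"
    and "SYM F"
  shows "\<exists>A>0. \<exists>S > F (- phi0).
           \<forall>M>0. \<exists>T0>0. \<forall>T>0. \<forall>(u :: (real^'n) \<times> real \<Rightarrow> real) L.
             AMCF_solution F T u \<and>
             (\<forall>y t. 0 \<le> t \<and> t \<le> T \<longrightarrow> \<bar>u (y, t)\<bar> \<le> M) \<and>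
             lattice L \<and>
             (\<forall>l\<in>L. \<forall>y t. 0 \<le> t \<and> t \<le> T \<longrightarrow> u (y + l, t) = u (y, t))
             \<longrightarrow> (\<forall>y t. 0 < t \<and> t \<le> min T T0 \<longrightarrow>
                   F (nu u (y, t)) \<le>
                     max (t * exp (A * (\<bar>u (y, t)\<bar> - 2 * M)\<^sup>2 / (2 * t))) S)"
proof -
  interpret anisotropy F by unfold_locales (rule assms)+
  obtain c S where c: "c > 0" and S: "S > F (- phi0)"
    and algebra: "\<And>p. S \<le> F (p, - 1) \<Longrightarrow> c \<le> F (p, - 1) * F00 (p, - 1) \<and>
      (\<forall>H a. (\<forall>i j. H i j = H j i) \<longrightarrow> (\<forall>j. (\<Sum>i\<in>UNIV. Xv (p, - 1) i * H i j) = a * p $ j) \<longrightarrow>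
        a * (F0 (p, - 1) * pairing (gm (p, - 1)) H + F (p, - 1) * pairing (Bm (p, - 1)) H)
          - F (p, - 1) * trace_sq (gm (p, - 1)) H \<le> - (3 / 2) * a\<^sup>2 * F00 (p, - 1))"
    using gradient_estimate_algebra by (elim exE conjE) (rule that, assumption+, blast)
  have Spos: "S > 0" using S F_pos[of "- phi0"] by (simp add: phi0_def prod_eq_iff)
  \<comment> \<open>The value for which A F F00 >= 2 wherever F >= S.\<close>
  define A where "A = 2 / c"
  have A: "A > 0" "2 \<le> A * c" using c by (auto simp: A_def)
  have "F (nu u (y, t)) \<le> t * exp (A * (\<bar>u (y, t)\<bar> - 2 * M)\<^sup>2 / (2 * t))"
    if M: "M > 0" and sol: "AMCF_solution F T u" and bound: "\<And>y t. 0 \<le> t \<and> t \<le> T \<longrightarrow> \<bar>u (y, t)\<bar> \<le> M"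
      and L: "lattice L" "\<forall>l\<in>L. \<forall>y t. 0 \<le> t \<and> t \<le> T \<longrightarrow> u (y + l, t) = u (y, t)"
      and t: "0 < t" "t \<le> T" "t \<le> A * M\<^sup>2 / 4" "t \<le> A\<^sup>2 * M ^ 4 / (8 * S)"
    for M T t :: real and u L y
  proof -
    obtain U where U: "open U" "UNIV \<times> {0..T} \<subseteq> U" "Ck_on 3 U u"
      using sol unfolding AMCF_solution_def by blast
    interpret anisotropic_graph F u U
      by unfold_locales (use U in \<open>simp_all only: numeral_3_eq_3\<close>)
    have pde: "ut u (y, t) = F (nu u (y, t)) * pairing (gm (nu u (y, t))) (\<lambda>i j. uij u i j (y, t))"
      if "0 \<le> t" "t \<le> T" for y t
    proof -
      have "ut u (y, t) = (\<Sum>i\<in>UNIV. \<Sum>j\<in>UNIV.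
            F (nu u (y, t)) * D2 F (nu u (y, t)) (phi i) (phi j) * uij u i j (y, t))"
        using sol that unfolding AMCF_solution_def by blast
      then show ?thesis
        by (simp add: pairing_def gm_def D2_def pd_def[abs_def] sum_distrib_left mult.assoc)
    qed
    \<comment> \<open>The comparison holds for both signs; the sign of u at the point in question
      selects the barrier with 2 M - |u|.\<close>
    define \<sigma> :: real where "\<sigma> = (if u (y, t) \<ge> 0 then 1 else - 1)"
    have "F (nu u (y, t)) \<le> t * exp (A * (2 * M - \<sigma> * u (y, t))\<^sup>2 / (2 * t))"
      by (rule spd_le_barrier[OF U(2) pde M _ L(1) _ _ A Spos t algebra]) (use bound L(2) in \<open>auto simp: \<sigma>_def\<close>)
    also have "(2 * M - \<sigma> * u (y, t))\<^sup>2 = (\<bar>u (y, t)\<bar> - 2 * M)\<^sup>2"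
      by (auto simp: \<sigma>_def power2_commute)
    finally show ?thesis .
  qed
  then have main: "F (nu u (y, t)) \<le> max (t * exp (A * (\<bar>u (y, t)\<bar> - 2 * M)\<^sup>2 / (2 * t))) S"
    if "M > 0" "AMCF_solution F T u" "\<forall>y t. 0 \<le> t \<and> t \<le> T \<longrightarrow> \<bar>u (y, t)\<bar> \<le> M"
      "lattice L" "\<forall>l\<in>L. \<forall>y t. 0 \<le> t \<and> t \<le> T \<longrightarrow> u (y + l, t) = u (y, t)"
      "0 < t" "t \<le> min T (min (A * M\<^sup>2 / 4) (A\<^sup>2 * M ^ 4 / (8 * S)))"
    for M T t :: real and u L y
    using that by (simp add: le_max_iff_disj)
  show ?thesis
  proof (rule exI[of _ A], intro conjI A(1), rule exI[of _ S], intro conjI S allI impI)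
    fix M :: real assume M: "M > 0"
    show "\<exists>T0>0. \<forall>T>0. \<forall>(u :: (real^'n) \<times> real \<Rightarrow> real) L.
             AMCF_solution F T u \<and>
             (\<forall>y t. 0 \<le> t \<and> t \<le> T \<longrightarrow> \<bar>u (y, t)\<bar> \<le> M) \<and>
             lattice L \<and>
             (\<forall>l\<in>L. \<forall>y t. 0 \<le> t \<and> t \<le> T \<longrightarrow> u (y + l, t) = u (y, t))
             \<longrightarrow> (\<forall>y t. 0 < t \<and> t \<le> min T T0 \<longrightarrow>
                   F (nu u (y, t)) \<le>
                     max (t * exp (A * (\<bar>u (y, t)\<bar> - 2 * M)\<^sup>2 / (2 * t))) S)"
    \<comment> \<open>The first entry makes psi_t negative, the second keeps the barrier above
      \<open>S\<close>; both are fixed by M, A and S before T and u are given.\<close>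
    proof (intro exI[of _ "min (A * M\<^sup>2 / 4) (A\<^sup>2 * M ^ 4 / (8 * S))"] conjI allI impI)
      show "0 < min (A * M\<^sup>2 / 4) (A\<^sup>2 * M ^ 4 / (8 * S))" using A M Spos by simp
    qed (elim conjE, rule main[OF M])
  qed
qed

end
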